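(* Let $m,n\ge 1$, let $\Phi:\mathbb R^n\to[0,\infty)$ and let $A_1(t),\dots,A_m(t)$ be real $n\times n$ matrices that are invertible for almost every $t$ in the support of $\Phi$. Let $\gamma_1,\dots,\gamma_m\in\mathbb R$, $\gamma=\gamma_1+\cdots+\gamma_m$, $\omega_i(x)=|x|^{\gamma_i}$ for $i=1,\dots,m$, and $\omega(x)=|x|^{\gamma}$. Let $q_1(\cdot),\dots,q_m(\cdot)\in\mathcal P_b(\mathbb R^n)$ and $q(\cdot)\in\mathcal P_b(\mathbb R^n)$ with $\frac1{q_1(\cdot)}+\cdots+\frac1{q_m(\cdot)}=\frac1{q(\cdot)}$, and let $\zeta>0$. Suppose that for almost every $t\in\operatorname{supp}(\Phi)$ and all $i=1,\dots,m$, $$q_i(A_i^{-1}(t)\cdot)\le \zeta\, q_i(\cdot)\quad\text{and}\quad \|1\|_{L^{r_i(t,\cdot)}}<\infty,\qquad \text{where } \frac1{r_i(t,\cdot)}=\frac1{q_i(A_i^{-1}(t)\cdot)}-\frac1{\zeta q_i(\cdot)},$$ and that $$\mathcal C_1=\int_{\mathbb R^n}\frac{\Phi(t)}{|t|^n}\prod_{i=1}^m c_{A_i,q_i,\gamma_i}(t)\,\|1\|_{L^{r_i(t,\cdot)}}\,dt<\infty,$$ where $$c_{A_i,q_i,\gamma_i}(t)=\max\{\|A_i(t)\|^{-\gamma_i},\|A_i^{-1}(t)\|^{\gamma_i}\}\,\max\{|\det A_i^{-1}(t)|^{1/q_{i+}},|\det A_i^{-1}(t)|^{1/q_{i-}}\}.$$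 Then the multilinear Hausdorff operator $H_{\Phi,\vec A}$ is bounded from $L^{\zeta q_1(\cdot)}_{\omega_1}\times\cdots\times L^{\zeta q_m(\cdot)}_{\omega_m}$ to $L^{q(\cdot)}_{\omega}$.
   Context: All functions and matrix-valued functions are Lebesgue measurable. The multilinear Hausdorff operator is $H_{\Phi,\vec A}(\vec f)(x)=\int_{\mathbb R^n}\frac{\Phi(t)}{|t|^n}\prod_{i=1}^m f_i(A_i(t)x)\,dt$, $x\in\mathbb R^n$, for $\vec f=(f_1,\dots,f_m)$ measurable functions $\mathbb R^n\to\mathbb C$, $\vec A=(A_1,\dots,A_m)$. Bounded means $\|H_{\Phi,\vec A}(\vec f)\|\le C\prod_i\|f_i\|$ with $C$ independent of $\vec f$, in the respective norms. For a matrix $A=(a_{ij})$, $\|A\|=(\sum_{i,j}|a_{ij}|^2)^{1/2}$. $\mathcal P(\mathbb R^n)$ is the set of measurable $p(\cdot):\mathbb R^n\to[1,\infty]$. For $p(\cdot)\in\mathcal P(\mathbb R^n)$ let $\Omega_\infty=\{x:p(x)=\infty\}$ and $F_p(g)=\int_{\mathbb R^n\setminus\Omega_\infty}|g(x)|^{p(x)}dx+\|g\|_{L^\infty(\Omega_\infty)}$; $L^{p(\cdot)}=L^{p(\cdot)}(\mathbb R^n)$ is the set of complex-valued measurable $f$ with $F_p(f/\eta)<\infty$ for some $\eta>0$, with norm $\|f\|_{L^{p(\cdot)}}=\inf\{\eta>0:F_p(f/\eta)\le1\}$. For a weight $\omega\ge 0$, $L^{p(\cdot)}_\omega$ is the set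 of $f$ with $f\omega\in L^{p(\cdot)}$, and $\|f\|_{L^{p(\cdot)}_\omega}=\|f\omega\|_{L^{p(\cdot)}}$. $q_-=\operatorname{ess\,inf}q$, $q_+=\operatorname{ess\,sup}q$ ($q_{i\pm}$ for $q_i$); $\mathcal P_b(\mathbb R^n)$ is the class of $q(\cdot)\in\mathcal P(\mathbb R^n)$ with $1<q_-\le q(x)\le q_+<\infty$ for all $x$. In $1/r$, $1/\infty=0$. *)

theory Defs
  imports "HOL-Analysis.Analysis" "HOL-Probability.Essential_Supremum"
begin

text \<open>
  Variable exponents take values in \<^typ>\<open>ennreal\<close>, so that \<open>\<infinity>\<close> is an admissible value and
  \<open>inverse \<infinity> = 0\<close>, \<open>inverse 0 = \<infinity>\<close>.  Measurability always means Lebesgue measurability.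
\<close>

definition var_exponents :: "((real^'n) \<Rightarrow> ennreal) set" where
  "var_exponents = {p \<in> borel_measurable lebesgue. \<forall>x. 1 \<le> p x}"

definition exp_minus :: "((real^'n) \<Rightarrow> ennreal) \<Rightarrow> ennreal" where
  "exp_minus p = Sup {c. AE x in lebesgue. c \<le> p x}"

definition exp_plus :: "((real^'n) \<Rightarrow> ennreal) \<Rightarrow> ennreal" where
  "exp_plus p = esssup lebesgue p"

definition var_exponents_b :: "((real^'n) \<Rightarrow> ennreal) set" where
  "var_exponents_b = {p \<in> var_exponents.
     1 < exp_minus p \<and> (\<forall>x. exp_minus p \<le> p x \<and> p x \<le> exp_plus p) \<and> exp_plus p < \<infinity>}"

text \<open>
  The modular, the norm and the space are defined for an arbitrary function \<open>p\<close>, not only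
  for members of \<^const>\<open>var_exponents\<close>.  The essential supremum over a null set is \<open>0\<close>, and the norm
  is \<open>\<infinity>\<close> if no admissible \<open>\<eta>\<close> exists.
\<close>

definition modular :: "((real^'n) \<Rightarrow> ennreal) \<Rightarrow> ((real^'n) \<Rightarrow> complex) \<Rightarrow> ennreal" where
  "modular p g =
     (\<integral>\<^sup>+x\<in>{x. p x \<noteq> \<infinity>}. ennreal (cmod (g x) powr enn2real (p x)) \<partial>lebesgue)
     + esssup (restrict_space lebesgue {x. p x = \<infinity>}) (\<lambda>x. ennreal (cmod (g x)))"

definition Lp_norm :: "((real^'n) \<Rightarrow> ennreal) \<Rightarrow> ((real^'n) \<Rightarrow> complex) \<Rightarrow> ennreal" where
  "Lp_norm p f = Inf {ennreal \<eta> | \<eta>. 0 < \<eta> \<and> modular p (\<lambda>x. f x / of_real \<eta>) \<le> 1}"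

definition Lp_space :: "((real^'n) \<Rightarrow> ennreal) \<Rightarrow> ((real^'n) \<Rightarrow> complex) set" where
  "Lp_space p =
     {f \<in> borel_measurable lebesgue. \<exists>\<eta>>0. modular p (\<lambda>x. f x / of_real \<eta>) < \<infinity>}"

definition wLp_norm ::
  "((real^'n) \<Rightarrow> ennreal) \<Rightarrow> ((real^'n) \<Rightarrow> real) \<Rightarrow> ((real^'n) \<Rightarrow> complex) \<Rightarrow> ennreal" where
  "wLp_norm p w f = Lp_norm p (\<lambda>x. f x * of_real (w x))"

definition wLp_space ::
  "((real^'n) \<Rightarrow> ennreal) \<Rightarrow> ((real^'n) \<Rightarrow> real) \<Rightarrow> ((real^'n) \<Rightarrow> complex) set" where
  "wLp_space p w = {f \<in> borel_measurable lebesgue. (\<lambda>x. f x * of_real (w x)) \<in> Lp_space p}"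

text \<open>
  The weight \<open>|x|\<^sup>g\<close>; its value at the origin is \<open>0\<close> for every \<open>g\<close>, which only concerns a null set.
\<close>

definition power_weight :: "real \<Rightarrow> (real^'n) \<Rightarrow> real" where
  "power_weight g x = norm x powr g"

definition supp :: "((real^'n) \<Rightarrow> real) \<Rightarrow> (real^'n) set" where
  "supp \<Phi> = closure {t. \<Phi> t \<noteq> 0}"

text \<open>The finite index type \<open>'m\<close> plays the role of \<open>{1, \<dots>, m}\<close>.\<close>

definition hausdorff_integrand ::
  "((real^'n) \<Rightarrow> real) \<Rightarrow> ('m::finite \<Rightarrow> (real^'n) \<Rightarrow> real^'n^'n) \<Rightarrow>
   ('m \<Rightarrow> (real^'n) \<Rightarrow> complex) \<Rightarrow> (real^'n) \<Rightarrow> (real^'n) \<Rightarrow> complex" where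
  "hausdorff_integrand \<Phi> A f x t =
     of_real (\<Phi> t / norm t ^ CARD('n)) * (\<Prod>i\<in>UNIV. f i (A i t *v x))"

definition hausdorff_op ::
  "((real^'n) \<Rightarrow> real) \<Rightarrow> ('m::finite \<Rightarrow> (real^'n) \<Rightarrow> real^'n^'n) \<Rightarrow>
   ('m \<Rightarrow> (real^'n) \<Rightarrow> complex) \<Rightarrow> (real^'n) \<Rightarrow> complex" where
  "hausdorff_op \<Phi> A f x = (LINT t|lebesgue. hausdorff_integrand \<Phi> A f x t)"

text \<open>
  The Bochner integral is total, with value \<open>0\<close> for a non-integrable function, so boundedness
  includes that the defining integral converges absolutely for almost every \<open>x\<close>.
\<close>

definition hausdorff_bounded ::
  "((real^'n) \<Rightarrow> real) \<Rightarrow> ('m::finite \<Rightarrow> (real^'n) \<Rightarrow> real^'n^'n) \<Rightarrow>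
   ('m \<Rightarrow> (real^'n) \<Rightarrow> ennreal) \<Rightarrow> ('m \<Rightarrow> (real^'n) \<Rightarrow> real) \<Rightarrow>
   ((real^'n) \<Rightarrow> ennreal) \<Rightarrow> ((real^'n) \<Rightarrow> real) \<Rightarrow> bool" where
  "hausdorff_bounded \<Phi> A p v q w \<longleftrightarrow>
     (\<exists>C::real. 0 \<le> C \<and>
        (\<forall>f. (\<forall>i. f i \<in> wLp_space (p i) (v i)) \<longrightarrow>
           (AE x in lebesgue. integrable lebesgue (hausdorff_integrand \<Phi> A f x)) \<and>
           hausdorff_op \<Phi> A f \<in> wLp_space q w \<and>
           wLp_norm q w (hausdorff_op \<Phi> A f)
             \<le> ennreal C * (\<Prod>i\<in>UNIV. wLp_norm (p i) (v i) (f i))))"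

text \<open>
  On \<^typ>\<open>real^'n^'n\<close> the library's \<^const>\<open>norm\<close> is the Frobenius norm
  \<open>(\<Sum>i j. |a i j|\<^sup>2)\<^sup>1\<^sup>/\<^sup>2\<close>, not the operator norm.
\<close>

definition c_const :: "real^'n^'n \<Rightarrow> ((real^'n) \<Rightarrow> ennreal) \<Rightarrow> real \<Rightarrow> real" where
  "c_const A q g =
     max (norm A powr (- g)) (norm (matrix_inv A) powr g) *
     max (\<bar>det (matrix_inv A)\<bar> powr (1 / enn2real (exp_plus q)))
         (\<bar>det (matrix_inv A)\<bar> powr (1 / enn2real (exp_minus q)))"

text \<open>
  The exponent \<open>r\<close> with \<open>1 / r = 1 / q (A\<^sup>-\<^sup>1 \<cdot>) - 1 / (\<zeta> q)\<close>.  Subtraction on \<^typ>\<open>ennreal\<close> is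
  truncated; this is immaterial where \<open>q (A\<^sup>-\<^sup>1 \<cdot>) \<le> \<zeta> q\<close>, and equality there gives \<open>r = \<infinity>\<close>.
\<close>

definition r_exponent ::
  "real^'n^'n \<Rightarrow> ((real^'n) \<Rightarrow> ennreal) \<Rightarrow> real \<Rightarrow> (real^'n) \<Rightarrow> ennreal" where
  "r_exponent A q \<zeta> x = inverse (inverse (q (matrix_inv A *v x)) - inverse (ennreal \<zeta> * q x))"

end

theory Submission
  imports Defs
begin

text \<open>
  The operator is the integral over \<open>t\<close> of the functions
  \<open>F\<^sub>t(x) = \<Phi>(t) |t|\<^sup>-\<^sup>n \<Prod>\<^sub>i f\<^sub>i(A\<^sub>i(t) x)\<close>, so by Minkowski's integral inequality it is enough to bound the
  weighted \<open>L\<^sup>q\<close> norm of each \<open>F\<^sub>t\<close> by \<open>2 m \<Phi>(t) |t|\<^sup>-\<^sup>n \<Prod>\<^sub>i c\<^sub>i(t) \<parallel>1\<parallel> \<parallel>f\<^sub>i\<parallel>\<close>, whose integral over \<open>t\<close> is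
  \<open>2 m\<close> times the finite constant of the hypothesis times the product of the norms of the \<open>f\<^sub>i\<close>.

  The bound for fixed \<open>t\<close> (\<open>Lp_norm_prod_dilated_le\<close>) uses modulars only.  Once each factor is divided by
  a number slightly above the norm expected of it, the product is handled by the pointwise inequality
  \<open>(\<Prod>\<^sub>i h\<^sub>i)\<^sup>q \<le> \<Sum>\<^sub>i h\<^sub>i\<^bsup>q\<^sub>i\<^esup>\<close> for \<open>1/q = \<Sum>\<^sub>i 1/q\<^sub>i\<close> (\<open>prod_powr_le_sum_powr\<close>), which is
  Hoelder's inequality on the level of modulars.  For a single factor
  (\<open>nn_integral_dilated_powr_le_2\<close>) the weight \<open>|x|\<^sup>\<gamma>\<close> is compared with \<open>|A x|\<^sup>\<gamma>\<close>, the substitution \<open>y = A x\<close>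
  turns the exponent \<open>q\<^sub>i(x)\<close> into \<open>q\<^sub>i(A\<^sup>-\<^sup>1 y)\<close> and costs the Jacobian, which the second maximum in
  \<open>c\<^sub>i(t)\<close> absorbs, and the same pointwise inequality for the splitting
  \<open>1/q\<^sub>i(A\<^sup>-\<^sup>1 y) = 1/r(y) + 1/(\<zeta> q\<^sub>i(y))\<close> separates the constant \<open>1\<close> from \<open>f\<^sub>i\<close>.

  Minkowski's inequality (\<open>Lp_norm_integral_le\<close>) holds with constant \<open>1\<close>, by convexity.  If
  \<open>N(t)\<close> strictly dominates the norm of \<open>F\<^sub>t\<close> and \<open>S = \<integral> N\<close>, then \<open>S\<^sup>-\<^sup>1 \<integral> F\<^sub>t dt\<close> is the average of the functions \<open>F\<^sub>t / N(t)\<close>,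
  each of modular at most \<open>1\<close>, against the probability density \<open>N / S\<close>, and the modular is convex.

  Two points of measure theory need care.  A Lebesgue measurable \<open>f\<^sub>i\<close> composed with \<open>(x, t) \<mapsto> A\<^sub>i(t) x\<close>
  may fail to be measurable for the product of the Lebesgue algebras, so every \<open>f\<^sub>i\<close> is replaced by a Borel
  function equal to it almost everywhere; as the \<open>A\<^sub>i(t)\<close> are invertible, this changes the integrand only on a
  null set of \<open>t\<close> for almost every \<open>x\<close> (\<open>AE_hausdorff_integrand_eq\<close>).  And the integral in the
  hypothesis is a supremum over simple functions, defined even if its integrand is not measurable in \<open>t\<close>; it is
  therefore compared with the norm of \<open>F\<^sub>t\<close>, which is measurable (\<open>borel_measurable_Lp_norm\<close>), by
  \<open>nn_integral_le_cmult_nonmeasurable\<close>.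
\<close>

section \<open>Linear changes of variables for the Lebesgue integral\<close>

lemma sigma_finite_lebesgue: "sigma_finite_measure (lebesgue :: 'a::euclidean_space measure)"
proof
  obtain C :: "'a set set" where C: "countable C" "C \<subseteq> sets lborel" "\<Union>C = space lborel" "\<forall>a\<in>C. emeasure lborel a \<noteq> \<infinity>"
    using lborel.sigma_finite_countable by blast
  then show "\<exists>A. countable A \<and> A \<subseteq> sets lebesgue \<and> \<Union> A = space (lebesgue :: 'a measure) \<and> (\<forall>a\<in>A. emeasure lebesgue a \<noteq> \<infinity>)"
    by (intro exI[of _ C]) auto
qed

interpretation lebesgue: sigma_finite_measure lebesgue
  by (rule sigma_finite_lebesgue)

interpretation lebesgue_pair: pair_sigma_finite lebesgue lebesgue ..

lemma matrix_vector_borel_measurable [measurable]: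
  "(\<lambda>x. (A :: real^'n^'m) *v x) \<in> borel \<rightarrow>\<^sub>M borel"
  by (intro borel_measurable_continuous_onI matrix_vector_mult_linear_continuous_on)

text \<open>
  The shear \<open>x \<mapsto> x + c x\<^sub>n e\<^sub>m\<close>.  Together with diagonal matrices and coordinate swaps, the shears with
  \<open>c = 1\<close> generate all square matrices; those with \<open>c = - 1\<close> are their inverses.
\<close>

definition transvection :: "'n \<Rightarrow> 'n \<Rightarrow> real \<Rightarrow> real^'n \<Rightarrow> real^'n" where
  "transvection m n c x = (\<chi> i. if i = m then x $ m + c * x $ n else x $ i)"

lemma linear_transvection: "m \<noteq> n \<Longrightarrow> linear (transvection m n c)"
  by (rule linearI) (auto simp: transvection_def vec_eq_iff algebra_simps)

lemma transvection_inverse: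
  "m \<noteq> n \<Longrightarrow> transvection m n c (transvection m n (- c) x) = x"
  by (auto simp: transvection_def vec_eq_iff)

lemma transvection_measurable [measurable]: "m \<noteq> n \<Longrightarrow> transvection m n c \<in> borel \<rightarrow>\<^sub>M borel"
  by (intro borel_measurable_continuous_onI linear_continuous_on linear_linear[THEN iffD2] linear_transvection)

text \<open>
  When the lower corner has a nonnegative \<open>n\<close>-th coordinate, this is \<open>measure_shear_interval\<close>.  Translating
  along \<open>e\<^sub>n\<close> reduces every box to this case, since shearing maps translates of a set to translates of its image.
\<close>

lemma measure_transvection_cbox:
  fixes m n :: "'n::finite"
  assumes "m \<noteq> n"
  shows "measure lebesgue (transvection m n 1 ` cbox a b) = measure lebesgue (cbox a b)"
proof (cases "cbox a b = {}")
  case False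
  let ?v = "\<chi> i. if i = n then \<bar>a $ n\<bar> else (0 :: real)"
  \<comment> \<open>Translating by \<open>?v\<close> makes the \<open>n\<close>-th coordinate of the lower corner nonnegative.\<close>
  have sh: "transvection m n 1 ` (+) ?v ` cbox a b = (+) (transvection m n 1 ?v) ` transvection m n 1 ` cbox a b"
    by (simp add: image_image linear_add[OF linear_transvection[OF assms]])
  have "measure lebesgue (transvection m n 1 ` cbox a b) = measure lebesgue (transvection m n 1 ` (+) ?v ` cbox a b)"
    unfolding sh by (rule measure_translation[symmetric])
  also have "\<dots> = measure lebesgue ((\<lambda>x. \<chi> i. if i = m then x$m + x$n else x$i) ` cbox (?v + a) (?v + b))"
    unfolding cbox_translation[symmetric] by (simp add: transvection_def[abs_def] cong: if_cong)
  also have "\<dots> = measure lebesgue (cbox (?v + a) (?v + b))"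
  proof (rule measure_shear_interval[OF assms])
    show "cbox (?v + a) (?v + b) \<noteq> {}"
      using False by (simp add: cbox_translation)
  qed simp
  also have "\<dots> = measure lebesgue (cbox a b)"
    unfolding cbox_translation by (rule measure_translation)
  finally show ?thesis .
qed simp

text \<open>
  The preimage of a box under the inverse shear is the image of the box under the shear, so the volume formula for
  images applies.  Passing from open to closed boxes is harmless because a shear maps the boundary to a null set.
\<close>

lemma distr_transvection:
  fixes m n :: "'n::finite"
  assumes mn: "m \<noteq> n"
  shows "distr lborel borel (transvection m n (-1)) = lborel"
proof (rule lborel_eqI[symmetric])
  note [measurable] = transvection_measurable[OF mn]
  fix l u :: "real^'n" assume le: "\<And>b. b \<in> Basis \<Longrightarrow> l \<bullet> b \<le> u \<bullet> b"
  let ?h = "transvection m n 1" and ?h' = "transvection m n (-1)"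
  have vim: "?h' -` S = ?h ` S" for S
    using transvection_inverse[OF mn, of 1] transvection_inverse[OF mn, of "-1"] 
    by (auto simp: image_iff) metis
  have bd: "?h ` (cbox l u - box l u) \<in> null_sets lebesgue"
    using negligible_differentiable_image_negligible[OF order_refl negligible_frontier_interval, of "transvection m n 1" l u]
      linear_imp_differentiable_on[OF linear_transvection[OF mn]]
    by (simp add: negligible_iff_null_sets)
  have "?h ` cbox l u \<in> lmeasurable"
    by (intro lmeasurable_compact compact_continuous_image linear_continuous_on
        linear_linear[THEN iffD2] linear_transvection mn compact_cbox)
  then have e: "emeasure lebesgue (?h ` cbox l u) = emeasure lebesgue (cbox l u)"
    by (simp add: emeasure_eq_measure2 measure_transvection_cbox[OF mn])
  have "emeasure (distr lborel borel ?h') (box l u) = emeasure lborel (?h ` box l u)"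
    by (simp add: emeasure_distr vim)
  also have "\<dots> = emeasure lebesgue (?h ` box l u \<union> ?h ` (cbox l u - box l u))"
  proof -
    have "?h ` box l u \<in> sets lborel"
      using measurable_sets[OF transvection_measurable[OF mn, of "- 1"], of "box l u"] by (simp add: vim)
    then show ?thesis
      using bd by (simp add: emeasure_Un_null_set)
  qed
  also have "?h ` box l u \<union> ?h ` (cbox l u - box l u) = ?h ` cbox l u"
    using box_subset_cbox[of l u] by auto
  finally show "emeasure (distr lborel borel ?h') (box l u) = (\<Prod>b\<in>Basis. (u - l) \<bullet> b)"
    using le by (simp add: e emeasure_lborel_cbox_eq)
qed simp

lemma prod_Basis_cart: "(\<Prod>b\<in>Basis. f b) = (\<Prod>i\<in>UNIV. f (axis i (1::real) :: real^'n))"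
proof -
  have Basis: "(Basis :: (real^'n) set) = (\<lambda>i. axis i 1) ` UNIV"
    by (auto simp: Basis_vec_def)
  have inj: "inj (\<lambda>i::'n. axis i (1::real))"
    by (auto simp: inj_on_def axis_eq_axis)
  show ?thesis
    unfolding Basis by (simp add: prod.reindex[OF inj])
qed

lemma distr_coordinate_swap:
  fixes m n :: "'n::finite"
  shows "distr lborel borel (\<lambda>x::real^'n. \<chi> i. x $ Transposition.transpose m n i) = lborel"
proof (rule lborel_eqI[symmetric])
  fix l u :: "real^'n" assume le: "\<And>b. b \<in> Basis \<Longrightarrow> l \<bullet> b \<le> u \<bullet> b"
  let ?t = "Transposition.transpose m n"
  let ?s = "\<lambda>x::real^'n. (\<chi> i. x $ ?t i)"
  have lin: "linear ?s"
    by (rule linearI) (auto simp: vec_eq_iff)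
  have [measurable]: "?s \<in> borel \<rightarrow>\<^sub>M borel"
    by (intro borel_measurable_continuous_onI linear_continuous_on linear_linear[THEN iffD2] lin)
  have all: "(\<forall>i. P (?t i)) \<longleftrightarrow> (\<forall>i. P i)" for P
    by (metis transpose_involutory)
  have "?s -` box l u = box (?s l) (?s u)"
    using all[of "\<lambda>i. l $ ?t i < x $ i \<and> x $ i < u $ ?t i" for x] by (auto simp: mem_box_cart)
  moreover have "(\<Prod>b\<in>Basis. f \<bullet> b) = (\<Prod>i\<in>UNIV. f $ i)" for f :: "real^'n"
    by (simp add: prod_Basis_cart inner_axis)
  moreover have "(\<Prod>i\<in>UNIV. (u - l) $ ?t i) = (\<Prod>i\<in>UNIV. (u - l) $ i)"
    by (rule prod.permute[OF permutes_swap_id, symmetric, unfolded o_def]) auto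
  moreover have "l $ i \<le> u $ i" for i
    using le[of "axis i 1"] by (simp add: inner_axis)
  moreover have "?s l \<bullet> b \<le> ?s u \<bullet> b" if "b \<in> Basis" for b
    using that \<open>\<And>i. l $ i \<le> u $ i\<close> by (auto simp: Basis_vec_def inner_axis)
  ultimately show "emeasure (distr lborel borel ?s) (box l u) = (\<Prod>b\<in>Basis. (u - l) \<bullet> b)"
    by (simp add: emeasure_distr emeasure_lborel_box_eq prod_Basis_cart)
qed simp

lemma lborel_diagonal_matrix:
  fixes A :: "real^'n^'n"
  assumes diag: "\<And>i j. i \<noteq> j \<Longrightarrow> A $ i $ j = 0" and "invertible A"
  shows "lborel = density (distr lborel borel (\<lambda>x. A *v x)) (\<lambda>_. \<bar>det A\<bar>)"
proof -
  from assms(2) have det: "det A = (\<Prod>i\<in>UNIV. A $ i $ i)" "\<And>i. A $ i $ i \<noteq> 0"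
    using det_diagonal[OF diag] by (auto simp: invertible_det_nz)
  define c where "c b = (\<Sum>i\<in>UNIV. A $ i $ i * b $ i)" for b :: "real^'n"
  have c: "c (axis i 1) = A $ i $ i" for i
    by (simp add: c_def axis_def if_distrib cong: if_cong)
  have Basis: "(Basis :: (real^'n) set) = (\<lambda>i. axis i 1) ` UNIV"
    by (auto simp: Basis_vec_def)
  have inj: "inj (\<lambda>i::'n. axis i (1::real))"
    by (auto simp: inj_on_def axis_eq_axis)
  have T: "0 + (\<Sum>j\<in>Basis. (c j * (x \<bullet> j)) *\<^sub>R j) = A *v x" for x
  proof -
    have "(\<Sum>j\<in>Basis. (c j * (x \<bullet> j)) *\<^sub>R j) = (\<Sum>i\<in>UNIV. (A $ i $ i * x $ i) *\<^sub>R axis i 1)"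
      unfolding Basis by (simp add: sum.reindex[OF inj] c inner_axis)
    also have "\<dots> = A *v x"
    proof (simp add: vec_eq_iff matrix_vector_mult_def, intro allI)
      fix i
      have "(\<Sum>j\<in>UNIV. A $ i $ j * x $ j) = (\<Sum>j\<in>UNIV. if j = i then A $ i $ i * x $ i else 0)"
        by (intro sum.cong) (auto simp: diag)
      then show "(\<Sum>j\<in>UNIV. A $ j $ j * x $ j * axis j 1 $ i) = (\<Sum>j\<in>UNIV. A $ i $ j * x $ j)"
        by (simp add: axis_def if_distrib cong: if_cong)
    qed
    finally show ?thesis by simp
  qed
  have pr: "(\<Prod>j\<in>Basis. \<bar>c j\<bar>) = \<bar>det A\<bar>"
    unfolding Basis by (simp add: prod.reindex[OF inj] c det(1) abs_prod)
  have "c j \<noteq> 0" if "j \<in> Basis" for j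
    using that det(2) by (auto simp: Basis c)
  from lborel_affine_euclidean[of c 0, OF this] show ?thesis
    unfolding T pr .
qed

lemma coordinate_swap_matrix:
  fixes m n :: "'n::finite"
  shows "(\<chi> i j. mat 1 $ i $ Transposition.transpose m n j) *v x = (\<chi> i. (x::real^'n) $ Transposition.transpose m n i)"
    and "\<bar>det (\<chi> i j. (mat 1 :: real^'n^'n) $ i $ Transposition.transpose m n j)\<bar> = 1"
proof -
  let ?t = "Transposition.transpose m n"
  have "(\<Sum>j\<in>UNIV. mat 1 $ i $ ?t j * x $ j) = (\<Sum>j\<in>UNIV. if j = ?t i then x $ ?t i else 0)" for i
    by (intro sum.cong refl) (auto simp: mat_def)
  then show "(\<chi> i j. mat 1 $ i $ ?t j) *v x = (\<chi> i. (x::real^'n) $ ?t i)"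
    by (simp add: vec_eq_iff matrix_vector_mult_def)
  show "\<bar>det (\<chi> i j. (mat 1 :: real^'n^'n) $ i $ Transposition.transpose m n j)\<bar> = 1"
    by (simp add: det_permute_columns permutes_swap_id sign_swap_id abs_mult)
qed

lemma transvection_matrix:
  fixes m n :: "'n::finite"
  assumes mn: "m \<noteq> n"
  defines "A \<equiv> (\<chi> i j. of_bool (i = m \<and> j = n \<or> i = j)) :: real^'n^'n"
  shows "A *v x = transvection m n 1 x" and "det A = 1"
proof -
  have "(\<Sum>j\<in>UNIV. of_bool (i = m \<and> j = n \<or> i = j) * x $ j) =
      (\<Sum>j\<in>UNIV. (if j = i then x $ i else 0) + (if j = n then of_bool (i = m) * x $ n else 0))" for i
    using mn by (intro sum.cong) auto
  then show "A *v x = transvection m n 1 x"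
    by (simp add: A_def vec_eq_iff matrix_vector_mult_def transvection_def sum.distrib)
  have "A = (\<chi> k. if k = m then row m (mat 1) + 1 *s row n (mat 1) else row k (mat 1))"
    using mn by (auto simp: A_def vec_eq_iff row_def mat_def)
  then show "det A = 1"
    using det_row_operation[OF mn, where c = 1 and A = "mat 1 :: real^'n^'n"] by simp
qed

text \<open>
  The formula is multiplicative in the matrix, so it only has to be checked on generators: diagonal matrices,
  coordinate swaps and shears.  A matrix with a zero row is not invertible and satisfies it vacuously.
\<close>

lemma nn_integral_lborel_matrix:
  fixes A :: "real^'n^'n"
  assumes "invertible A" and "f \<in> borel_measurable borel"
  shows "(\<integral>\<^sup>+x. f x \<partial>lborel) = ennreal \<bar>det A\<bar> * (\<integral>\<^sup>+x. f (A *v x) \<partial>lborel)"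
proof -
  define P where "P A \<longleftrightarrow> (invertible A \<longrightarrow> (\<forall>f\<in>borel_measurable borel.
      (\<integral>\<^sup>+x. f x \<partial>lborel) = ennreal \<bar>det A\<bar> * (\<integral>\<^sup>+x. f (A *v x) \<partial>lborel)))" for A :: "real^'n^'n"
  have unimodular: "P B" if distr: "distr lborel borel ((*v) B) = lborel" and det: "\<bar>det B\<bar> = 1" for B
    unfolding P_def
  proof (intro impI ballI)
    fix f :: "real^'n \<Rightarrow> ennreal" assume f: "f \<in> borel_measurable borel"
    have "(\<integral>\<^sup>+x. f x \<partial>distr lborel borel ((*v) B)) = (\<integral>\<^sup>+x. f (B *v x) \<partial>lborel)"
      using f by (intro nn_integral_distr) simp_all
    then show "(\<integral>\<^sup>+x. f x \<partial>lborel) = ennreal \<bar>det B\<bar> * (\<integral>\<^sup>+x. f (B *v x) \<partial>lborel)"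
      unfolding distr det ennreal_1 mult_1_left .
  qed
  have "P A"
  proof (rule induct_matrix_elementary_alt)
    fix A B :: "real^'n^'n" assume IH: "P A" "P B"
    show "P (A ** B)"
      unfolding P_def
    proof (intro impI ballI)
      fix f :: "real^'n \<Rightarrow> ennreal" assume f[measurable]: "f \<in> borel_measurable borel"
      assume "invertible (A ** B)"
      then have AB: "invertible A" "invertible B"
        by (simp_all add: invertible_det_nz det_mul)
      have fA: "(\<lambda>x. f (A *v x)) \<in> borel_measurable borel"
        by measurable
      show "(\<integral>\<^sup>+x. f x \<partial>lborel) = ennreal \<bar>det (A ** B)\<bar> * (\<integral>\<^sup>+x. f ((A ** B) *v x) \<partial>lborel)"
        unfolding IH(1)[unfolded P_def, rule_format, OF AB(1) f] IH(2)[unfolded P_def, rule_format, OF AB(2) fA]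
          matrix_vector_mul_assoc det_mul abs_mult ennreal_mult[OF abs_ge_zero abs_ge_zero] mult.assoc ..
    qed
  next
    fix A :: "real^'n^'n" and i assume "row i A = 0"
    then have "\<not> invertible A"
      by (simp add: invertible_det_nz det_zero_row)
    then show "P A" by (simp add: P_def)
  next
    fix A :: "real^'n^'n" assume diag: "\<And>i j. i \<noteq> j \<Longrightarrow> A $ i $ j = 0"
    show "P A"
      unfolding P_def
    proof (intro impI ballI)
      fix f :: "real^'n \<Rightarrow> ennreal" assume [measurable]: "f \<in> borel_measurable borel"
      assume "invertible A"
      from lborel_diagonal_matrix[OF diag this]
      have "(\<integral>\<^sup>+x. f x \<partial>lborel) = (\<integral>\<^sup>+x. f x \<partial>density (distr lborel borel (\<lambda>x. A *v x)) (\<lambda>_. \<bar>det A\<bar>))"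
        by simp
      also have "\<dots> = ennreal \<bar>det A\<bar> * (\<integral>\<^sup>+x. f (A *v x) \<partial>lborel)"
        by (simp add: nn_integral_density nn_integral_cmult nn_integral_distr)
      finally show "(\<integral>\<^sup>+x. f x \<partial>lborel) = ennreal \<bar>det A\<bar> * (\<integral>\<^sup>+x. f (A *v x) \<partial>lborel)" .
    qed
  next
    fix m n :: 'n assume mn: "m \<noteq> n"
    let ?A = "(\<chi> i j. mat 1 $ i $ Transposition.transpose m n j) :: real^'n^'n"
    have "(*v) ?A = (\<lambda>x. \<chi> i. x $ Transposition.transpose m n i)"
      by (rule ext) (rule coordinate_swap_matrix(1))
    then have "distr lborel borel ((*v) ?A) = lborel"
      by (simp only: distr_coordinate_swap)
    then show "P ?A"
      by (rule unimodular) (rule coordinate_swap_matrix(2))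
  next
    fix m n :: 'n assume mn: "m \<noteq> n"
    note [measurable] = transvection_measurable[OF mn]
    have "(\<integral>\<^sup>+x. f x \<partial>lborel) = (\<integral>\<^sup>+x. f (transvection m n 1 x) \<partial>lborel)"
      if [measurable]: "f \<in> borel_measurable borel" for f
    proof -
      have "(\<integral>\<^sup>+x. f (transvection m n 1 x) \<partial>lborel)
          = (\<integral>\<^sup>+x. f (transvection m n 1 x) \<partial>distr lborel borel (transvection m n (-1)))"
        by (simp add: distr_transvection[OF mn])
      also have "\<dots> = (\<integral>\<^sup>+x. f x \<partial>lborel)"
        by (subst nn_integral_distr) (auto simp: transvection_inverse[OF mn])
      finally show ?thesis by simp
    qed
    then show "P (\<chi> i j. of_bool (i = m \<and> j = n \<or> i = j))"
      unfolding P_def transvection_matrix[OF mn] abs_one ennreal_1 mult_1_left by blast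
  qed
  then show ?thesis using assms unfolding P_def by blast
qed

text \<open>
  The substitution formula for the indicator of a null set shows that invertible matrices pull null sets back to
  null sets; this is what extends it from Borel to Lebesgue measurable functions.
\<close>

lemma AE_lborel_matrix:
  fixes A :: "real^'n^'n"
  assumes inv: "invertible A" and "AE x in lborel. P x"
  shows "AE x in lborel. P (A *v x)"
proof -
  obtain N where N: "{x. \<not> P x} \<subseteq> N" "N \<in> sets borel" "emeasure lborel N = 0"
    using assms(2) by (auto elim!: AE_E)
  \<comment> \<open>As \<open>det A \<noteq> 0\<close>, the preimage of \<open>N\<close> has measure zero as well.\<close>
  then have "ennreal \<bar>det A\<bar> * (\<integral>\<^sup>+x. indicator N (A *v x) \<partial>lborel) = 0"
    using nn_integral_lborel_matrix[OF inv, of "indicator N"] by simp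
  then have "(\<integral>\<^sup>+x. indicator N (A *v x) \<partial>lborel) = 0"
    using inv by (auto simp: invertible_det_nz)
  moreover have "(\<lambda>x. indicator N (A *v x) :: ennreal) \<in> borel_measurable lborel"
    using N(2) by measurable
  ultimately have "AE x in lborel. indicator N (A *v x) = (0::ennreal)"
    by (simp add: nn_integral_0_iff_AE)
  then show ?thesis
    by (rule eventually_mono) (use N(1) in \<open>auto simp: indicator_def split: if_splits\<close>)
qed

lemma lebesgue_measurable_matrix:
  fixes A :: "real^'n^'n"
  assumes inv: "invertible A"
  shows "(\<lambda>x. A *v x) \<in> lebesgue \<rightarrow>\<^sub>M lebesgue"
proof (rule completion.measurable_completion2)
  show "(\<lambda>x. A *v x) \<in> lebesgue \<rightarrow>\<^sub>M lborel"
    by (intro measurable_completion) simp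
  show "null_sets lborel \<subseteq> null_sets (distr lebesgue lborel (\<lambda>x. A *v x))"
  proof
    fix N :: "(real^'n) set" assume N: "N \<in> null_sets lborel"
    then have "AE x in lborel. A *v x \<notin> N"
      by (intro AE_lborel_matrix[OF inv] AE_not_in)
    then have "AE x in lebesgue. A *v x \<notin> N"
      by (rule AE_completion)
    then have "(\<lambda>x. A *v x) -` N \<in> null_sets lebesgue"
      by (simp add: completion.AE_iff_null_sets vimage_def)
    then show "N \<in> null_sets (distr lebesgue lborel (\<lambda>x. A *v x))"
      using N by (auto simp: null_sets_def emeasure_distr measurable_completion)
  qed
qed

lemma nn_integral_lebesgue_matrix:
  fixes A :: "real^'n^'n"
  assumes inv: "invertible A" and f: "f \<in> borel_measurable lebesgue"
  shows "(\<integral>\<^sup>+x. f x \<partial>lebesgue) = ennreal \<bar>det A\<bar> * (\<integral>\<^sup>+x. f (A *v x) \<partial>lebesgue)"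
proof -
  obtain f' where f': "f' \<in> borel_measurable lborel" "AE x in lborel. f x = f' x"
    using completion_ex_borel_measurable[OF f] by blast
  have "(\<integral>\<^sup>+x. f x \<partial>lborel) = (\<integral>\<^sup>+x. f' x \<partial>lborel)"
    by (rule nn_integral_cong_AE[OF f'(2)])
  also have "\<dots> = ennreal \<bar>det A\<bar> * (\<integral>\<^sup>+x. f' (A *v x) \<partial>lborel)"
    using f'(1) by (intro nn_integral_lborel_matrix[OF inv]) simp
  also have "(\<integral>\<^sup>+x. f' (A *v x) \<partial>lborel) = (\<integral>\<^sup>+x. f (A *v x) \<partial>lborel)"
    by (rule nn_integral_cong_AE) (use AE_lborel_matrix[OF inv f'(2)] in \<open>simp add: eq_commute\<close>)
  finally show ?thesis
    by (simp only: nn_integral_completion)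
qed

section \<open>Inequalities for powers\<close>

text \<open>
  Hoelder's inequality for modulars.  With \<open>Y\<close> the right-hand side, each \<open>h\<^sub>i\<close> is at most \<open>Y\<^bsup>1/p\<^sub>i\<^esup>\<close>, so
  the product is at most \<open>Y\<^bsup>1/q\<^esup>\<close>.
\<close>

lemma prod_powr_le_sum_powr:
  fixes h p :: "'i \<Rightarrow> real"
  assumes "finite I" and h: "\<And>i. i \<in> I \<Longrightarrow> 0 \<le> h i" and p: "\<And>i. i \<in> I \<Longrightarrow> 0 < p i"
    and q: "0 < q" "(\<Sum>i\<in>I. 1 / p i) = 1 / q"
  shows "(\<Prod>i\<in>I. h i) powr q \<le> (\<Sum>i\<in>I. h i powr p i)"
proof (cases "\<exists>i\<in>I. h i = 0")
  case True
  then have "(\<Prod>i\<in>I. h i) = 0"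
    using \<open>finite I\<close> by simp
  then show ?thesis
    by (simp add: sum_nonneg)
next
  case False
  define Y where "Y = (\<Sum>i\<in>I. h i powr p i)"
  have hY: "h i powr p i \<le> Y" if "i \<in> I" for i
    unfolding Y_def using \<open>finite I\<close> that by (intro member_le_sum) auto
  have "I \<noteq> {}"
    using q by auto
  then obtain j where "j \<in> I" by blast
  then have "0 < h j powr p j"
    using False by simp
  with hY[OF \<open>j \<in> I\<close>] have Y: "0 < Y" by linarith
  have "(\<Prod>i\<in>I. h i) \<le> (\<Prod>i\<in>I. Y powr (1 / p i))"
  proof (intro prod_mono conjI h)
    fix i assume i: "i \<in> I"
    have "h i = (h i powr p i) powr (1 / p i)"
      using h[OF i] p[OF i] by (simp add: powr_powr)
    also have "\<dots> \<le> Y powr (1 / p i)"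
      using p[OF i] hY[OF i] by (intro powr_mono2) auto
    finally show "h i \<le> Y powr (1 / p i)" .
  qed
  also have "\<dots> = Y powr (1 / q)"
    using Y powr_sum[of Y "\<lambda>i. 1 / p i" I] q by simp
  finally have "(\<Prod>i\<in>I. h i) powr q \<le> (Y powr (1 / q)) powr q"
    using q h by (intro powr_mono2) (auto intro: prod_nonneg)
  also have "\<dots> = Y"
    using q Y by (simp add: powr_powr)
  finally show ?thesis
    by (simp add: Y_def)
qed

lemma mult_powr_le_add_powr:
  fixes u v p r s :: real
  assumes "0 \<le> u" "0 \<le> v" "0 < p" "0 < r" "0 < s" and "1 / p + 1 / r = 1 / s"
  shows "(u * v) powr s \<le> u powr p + v powr r"
  using prod_powr_le_sum_powr[of UNIV "\<lambda>b. if b then u else v" "\<lambda>b. if b then p else r" s] assms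
  by (simp add: UNIV_bool add.commute mult.commute)

text \<open>
  A convex function lies above its tangent at \<open>a\<close>.  After scaling to \<open>a = 1\<close> this is Young's inequality for
  \<open>y = (y\<^sup>p)\<^bsup>1/p\<^esup> \<cdot> 1\<^bsup>1 - 1/p\<^esup>\<close>.
\<close>

lemma powr_ge_tangent:
  fixes a h p :: real
  assumes "0 < a" "0 \<le> h" "1 \<le> p"
  shows "a powr p + p * a powr (p - 1) * (h - a) \<le> h powr p"
proof -
  have "1 + p * (y - 1) \<le> y powr p" if y: "0 \<le> y" for y :: real
  proof (cases "y = 0")
    case True
    then show ?thesis using assms by simp
  next
    case False
    with y have "(y powr p) powr (1 / p) * 1 powr (1 - 1 / p) \<le> 1 / p * y powr p + (1 - 1 / p) * 1"
      using assms by (intro Youngs_inequality_0) auto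
    then have "y \<le> 1 / p * y powr p + (1 - 1 / p)"
      using assms y by (simp add: powr_powr)
    then have "p * y \<le> p * (1 / p * y powr p + (1 - 1 / p))"
      using assms by (intro mult_left_mono) auto
    then show ?thesis
      using assms by (simp add: algebra_simps)
  qed
  from this[of "h / a"] have "a powr p * (1 + p * (h / a - 1)) \<le> a powr p * (h / a) powr p"
    using assms by (intro mult_left_mono) auto
  also have "\<dots> = h powr p"
    using assms by (simp add: powr_divide)
  also have "a powr p * (1 + p * (h / a - 1)) = a powr p + p * a powr (p - 1) * (h - a)"
    using assms by (simp add: powr_diff field_simps)
  finally show ?thesis .
qed

text \<open>
  Jensen's inequality for a density \<open>w\<close> of total mass \<open>W \<le> 1\<close>: integrating the tangent inequality at the mean \<open>a\<close>
  gives \<open>a\<^sup>p (W + p (1 - W))\<close> as a lower bound, and this is at least \<open>a\<^sup>p\<close> because \<open>p \<ge> 1\<close>.  Integrability of \<open>h w\<close>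
  comes from \<open>h \<le> 1 + h\<^sup>p\<close>.
\<close>

lemma jensen_powr_subprobability:
  fixes h w :: "'t \<Rightarrow> real"
  assumes [measurable]: "h \<in> borel_measurable T" "w \<in> borel_measurable T"
    and h: "\<And>t. 0 \<le> h t" and w: "\<And>t. 0 \<le> w t" and p: "1 \<le> p"
    and w1: "(\<integral>\<^sup>+t. ennreal (w t) \<partial>T) \<le> 1"
    and fin: "(\<integral>\<^sup>+t. ennreal (h t powr p * w t) \<partial>T) < \<infinity>"
  shows "integrable T (\<lambda>t. h t * w t)"
    and "ennreal ((\<integral>t. h t * w t \<partial>T) powr p) \<le> (\<integral>\<^sup>+t. ennreal (h t powr p * w t) \<partial>T)"
proof -
  have iw: "integrable T w"
    using w1 w by (intro integrableI_nonneg) (auto intro: order_le_less_trans)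
  have ip: "integrable T (\<lambda>t. h t powr p * w t)"
    using fin w by (intro integrableI_nonneg) auto
  have "h t * w t \<le> w t + h t powr p * w t" for t
  proof -
    have "h t \<le> 1 + h t powr p"
    proof (cases "h t \<le> 1")
      case False
      then have "h t powr 1 \<le> h t powr p"
        using p by (intro powr_mono) auto
      then show ?thesis using False by simp
    qed (simp add: add_increasing2)
    from mult_right_mono[OF this w[of t]] show ?thesis
      by (simp add: algebra_simps)
  qed
  then show ihw: "integrable T (\<lambda>t. h t * w t)"
    using h w by (intro Bochner_Integration.integrable_bound[OF Bochner_Integration.integrable_add[OF iw ip]]) (auto simp: abs_mult)
  define a where "a = (\<integral>t. h t * w t \<partial>T)"
  define W where "W = (\<integral>t. w t \<partial>T)"
  have W: "W \<le> 1"
  proof -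
    have "ennreal W \<le> 1"
      using w1 nn_integral_eq_integral[OF iw] w by (simp add: W_def)
    then show ?thesis by simp
  qed
  have a0: "0 \<le> a"
    unfolding a_def using h w by (intro integral_nonneg_AE) auto
  have "a powr p \<le> (\<integral>t. h t powr p * w t \<partial>T)"
  proof (cases "a = 0")
    case True
    then show ?thesis using w by (simp add: integral_nonneg_AE)
  next
    case False
    with a0 have a: "0 < a" by simp
    have "a powr p \<le> a powr p * W + p * a powr (p - 1) * (a - a * W)"
    proof -
      have "a powr (p - 1) * a = a powr p"
        using a by (simp add: powr_diff)
      then have "a powr p * W + p * a powr (p - 1) * (a - a * W) = a powr p * (1 + (p - 1) * (1 - W))"
        by (simp add: algebra_simps)
      moreover have "a powr p * 1 \<le> a powr p * (1 + (p - 1) * (1 - W))"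
        using p W by (intro mult_left_mono) auto
      ultimately show ?thesis by simp
    qed
    also have "\<dots> = (\<integral>t. a powr p * w t + p * a powr (p - 1) * (h t * w t - a * w t) \<partial>T)"
      using iw ihw by (simp add: a_def W_def)
    also have "\<dots> \<le> (\<integral>t. h t powr p * w t \<partial>T)"
    proof (rule integral_mono)
      show "integrable T (\<lambda>t. a powr p * w t + p * a powr (p - 1) * (h t * w t - a * w t))"
        using iw ihw by simp
      fix t
      from mult_right_mono[OF powr_ge_tangent[OF a h p] w, of t t]
      show "a powr p * w t + p * a powr (p - 1) * (h t * w t - a * w t) \<le> h t powr p * w t"
        by (simp add: algebra_simps)
    qed (rule ip)
    finally show ?thesis .
  qed
  then show "ennreal ((\<integral>t. h t * w t \<partial>T) powr p) \<le> (\<integral>\<^sup>+t. ennreal (h t powr p * w t) \<partial>T)"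
    using nn_integral_eq_integral[OF ip] w by (simp add: a_def ennreal_leI)
qed

section \<open>Modular and norm of variable exponent Lebesgue spaces\<close>

lemma borel_measurable_power_weight [measurable]:
  "power_weight g \<in> borel_measurable (lebesgue :: (real^'n) measure)"
  unfolding power_weight_def[abs_def] by (intro measurable_completion) measurable

lemma modular_finite_exponent:
  assumes "\<And>x. p x \<noteq> \<infinity>"
  shows "modular p g = (\<integral>\<^sup>+x. ennreal (cmod (g x) powr enn2real (p x)) \<partial>lebesgue)"
proof -
  have empty: "{x. p x = \<infinity>} = {}" and UNIV: "{x. p x \<noteq> \<infinity>} = UNIV"
    using assms by auto
  have "esssup (restrict_space lebesgue {}) (\<lambda>x. ennreal (cmod (g x))) \<le> 0"
    by (rule esssup_I) (auto simp: space_restrict_space measurable_def AE_restrict_space_iff)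
  then show ?thesis
    unfolding modular_def empty UNIV by simp
qed

lemma modular_divide_antimono:
  assumes [measurable]: "f \<in> borel_measurable lebesgue" and "0 < a" "a \<le> b"
  shows "modular p (\<lambda>x. f x / of_real b) \<le> modular p (\<lambda>x. f x / of_real a)"
proof -
  have le: "cmod (f x / of_real b) \<le> cmod (f x / of_real a)" for x
    using assms by (simp add: norm_divide frac_le)
  show ?thesis
    unfolding modular_def
    by (intro add_mono nn_integral_mono mult_right_mono ennreal_leI powr_mono2 le esssup_mono
        measurable_restrict_space1) auto
qed

lemma Lp_norm_le:
  assumes "0 < \<eta>" and "modular p (\<lambda>x. f x / of_real \<eta>) \<le> 1"
  shows "Lp_norm p f \<le> ennreal \<eta>"
  unfolding Lp_norm_def using assms by (intro Inf_lower) auto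

text \<open>
  The infimum defining the norm is approached from above; the strict inequality avoids the question whether it is
  attained.
\<close>

lemma modular_le_1_if_Lp_norm_less:
  assumes "f \<in> borel_measurable lebesgue" and "Lp_norm p f < ennreal \<eta>"
  shows "modular p (\<lambda>x. f x / of_real \<eta>) \<le> 1"
proof -
  obtain a where a: "0 < a" "modular p (\<lambda>x. f x / of_real a) \<le> 1" "ennreal a < ennreal \<eta>"
    using assms(2) unfolding Lp_norm_def Inf_less_iff by blast
  then have "a \<le> \<eta>"
    by (simp add: ennreal_less_iff)
  then show ?thesis
    using modular_divide_antimono[OF assms(1) a(1), of \<eta> p] a(2) by (meson order_trans)
qed

text \<open>
  Membership in the space only bounds a modular by some finite \<open>M \<ge> 1\<close>.  As the exponent is at least \<open>a > 0\<close>, dividing by a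
  further factor \<open>M\<^bsup>1/a\<^esup>\<close> brings the modular down to \<open>1\<close>.
\<close>

lemma Lp_norm_finite:
  assumes f: "f \<in> Lp_space p" and p: "\<And>x. p x \<noteq> \<infinity>" and pm: "p \<in> borel_measurable lebesgue"
    and a: "0 < a" "\<And>x. a \<le> enn2real (p x)"
  shows "Lp_norm p f < \<infinity>"
proof -
  note [measurable] = pm
  have [measurable]: "f \<in> borel_measurable lebesgue"
    using f by (simp add: Lp_space_def)
  obtain \<eta> where \<eta>: "0 < \<eta>" "modular p (\<lambda>x. f x / of_real \<eta>) < \<infinity>"
    using f by (auto simp: Lp_space_def)
  define M where "M = enn2real (modular p (\<lambda>x. f x / of_real \<eta>)) + 1"
  have M: "modular p (\<lambda>x. f x / of_real \<eta>) \<le> ennreal M" "1 \<le> M"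
    using \<eta>(2) by (auto simp: M_def ennreal_plus[symmetric] simp del: ennreal_plus)
       (metis ennreal_enn2real ennreal_leI enn2real_nonneg le_add_same_cancel1 zero_le_one infinity_ennreal_def)
  define l where "l = M powr (1 / a)"
  have l: "1 \<le> l" "l powr a = M"
    using a(1) M(2) by (auto simp: l_def powr_powr intro: ge_one_powr_ge_zero)
  have "modular p (\<lambda>x. f x / of_real (\<eta> * l))
      = (\<integral>\<^sup>+x. ennreal (cmod (f x / of_real \<eta>) powr enn2real (p x) / l powr enn2real (p x)) \<partial>lebesgue)"
    using l(1) \<eta>(1) by (simp add: modular_finite_exponent[OF p] norm_divide norm_mult powr_divide powr_mult field_simps)
  also have "\<dots> \<le> (\<integral>\<^sup>+x. ennreal (1 / M) * ennreal (cmod (f x / of_real \<eta>) powr enn2real (p x)) \<partial>lebesgue)"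
  proof (intro nn_integral_mono)
    fix x
    have "M \<le> l powr enn2real (p x)"
      using l powr_mono[OF a(2)[of x] l(1)] by simp
    then have "cmod (f x / of_real \<eta>) powr enn2real (p x) / l powr enn2real (p x) \<le> 1 / M * (cmod (f x / of_real \<eta>) powr enn2real (p x))"
      using M(2) by (simp add: frac_le)
    then show "ennreal (cmod (f x / of_real \<eta>) powr enn2real (p x) / l powr enn2real (p x))
      \<le> ennreal (1 / M) * ennreal (cmod (f x / of_real \<eta>) powr enn2real (p x))"
      using M(2) by (simp add: ennreal_mult'[symmetric] ennreal_leI del: times_divide_eq_left)
  qed
  also have "\<dots> = ennreal (1 / M) * modular p (\<lambda>x. f x / of_real \<eta>)"
    unfolding modular_finite_exponent[OF p] by (intro nn_integral_cmult) measurable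
  also have "\<dots> \<le> ennreal (1 / M) * ennreal M"
    by (intro mult_left_mono M) simp
  also have "\<dots> = 1"
    using M(2) by (simp add: ennreal_mult'[symmetric])
  finally have "modular p (\<lambda>x. f x / of_real (\<eta> * l)) \<le> 1" .
  then have "Lp_norm p f \<le> ennreal (\<eta> * l)"
    using \<eta>(1) l(1) by (intro Lp_norm_le) auto
  then show ?thesis
    by (metis ennreal_less_top infinity_ennreal_def order_le_less_trans)
qed

lemma Lp_space_if_Lp_norm_finite:
  assumes "f \<in> borel_measurable lebesgue" and "Lp_norm p f < \<infinity>"
  shows "f \<in> Lp_space p"
proof -
  obtain a where "0 < a" "modular p (\<lambda>x. f x / of_real a) \<le> 1"
    using assms(2) unfolding Lp_norm_def Inf_less_iff by blast
  moreover have "(1::ennreal) < \<infinity>" by simp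
  ultimately show ?thesis
    using assms(1) unfolding Lp_space_def by (blast intro: order_le_less_trans)
qed

lemma modular_mono_AE:
  assumes p: "\<And>x. p x \<noteq> \<infinity>" and "AE x in lebesgue. cmod (f x) \<le> cmod (g x)"
  shows "modular p f \<le> modular p g"
  unfolding modular_finite_exponent[OF p]
  by (rule nn_integral_mono_AE, rule eventually_mono[OF assms(2)]) (simp add: ennreal_leI powr_mono2)

lemma Lp_norm_mono_AE:
  assumes p: "\<And>x. p x \<noteq> \<infinity>" and le: "AE x in lebesgue. cmod (f x) \<le> cmod (g x)"
  shows "Lp_norm p f \<le> Lp_norm p g"
  unfolding Lp_norm_def
proof (intro Inf_superset_mono Collect_mono impI; elim exE conjE, intro exI conjI)
  fix \<eta> :: real assume \<eta>: "0 < \<eta>" and 1: "modular p (\<lambda>x. g x / of_real \<eta>) \<le> 1"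
  have "modular p (\<lambda>x. f x / of_real \<eta>) \<le> modular p (\<lambda>x. g x / of_real \<eta>)"
    by (intro modular_mono_AE p) (rule eventually_mono[OF le], use \<eta> in \<open>simp add: norm_divide divide_right_mono\<close>)
  then show "modular p (\<lambda>x. f x / of_real \<eta>) \<le> 1"
    using 1 by (rule order_trans)
qed auto

lemma Lp_norm_eq_0:
  assumes p: "\<And>x. p x \<noteq> \<infinity>" and "AE x in lebesgue. f x = 0"
  shows "Lp_norm p f = 0"
proof -
  have "Lp_norm p f \<le> ennreal \<eta>" if "0 < \<eta>" for \<eta>
  proof (rule Lp_norm_le[OF that])
    have "modular p (\<lambda>x. f x / of_real \<eta>) \<le> modular p (\<lambda>x. 0)"
      by (intro modular_mono_AE p) (rule eventually_mono[OF assms(2)], simp)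
    then show "modular p (\<lambda>x. f x / of_real \<eta>) \<le> 1"
      by (simp add: modular_finite_exponent[OF p])
  qed
  then have "Lp_norm p f \<le> 0 + ennreal e" if "0 < e" for e
    using that by simp
  then have "Lp_norm p f \<le> 0"
    using ennreal_le_epsilon by blast
  then show ?thesis by simp
qed

text \<open>
  By monotonicity of the modular in \<open>\<eta>\<close>, the infimum defining the norm may be taken over rational \<open>\<eta>\<close>, which makes
  it a countable infimum of functions that are measurable by Tonelli's theorem.
\<close>

lemma borel_measurable_Lp_norm:
  fixes K :: "(real^'n) \<Rightarrow> 't \<Rightarrow> real"
  assumes p: "\<And>x. p x \<noteq> \<infinity>"
    and [measurable]: "p \<in> borel_measurable lebesgue"
    and K[measurable]: "(\<lambda>z. K (fst z) (snd z)) \<in> borel_measurable (lebesgue \<Otimes>\<^sub>M T)"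
  shows "(\<lambda>t. Lp_norm p (\<lambda>x. of_real (K x t))) \<in> borel_measurable T"
proof -
  define F where "F \<eta> t = (\<integral>\<^sup>+x. ennreal ((\<bar>K x t\<bar> / \<eta>) powr enn2real (p x)) \<partial>lebesgue)" for \<eta> t
  have mod: "modular p (\<lambda>x. of_real (K x t) / of_real \<eta>) = F \<eta> t" if "0 < \<eta>" for t \<eta>
    using that by (simp add: modular_finite_exponent[OF p] F_def norm_divide)
  have [measurable]: "F \<eta> \<in> borel_measurable T" for \<eta>
  proof -
    have [measurable]: "(\<lambda>z. K (snd z) (fst z)) \<in> borel_measurable (T \<Otimes>\<^sub>M lebesgue)"
      using measurable_compose[OF measurable_pair_swap' K] by (simp add: split_beta)
    show ?thesis
      unfolding F_def by measurable
  qed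
  have eq: "Lp_norm p (\<lambda>x. of_real (K x t))
    = (INF r\<in>{0<..} :: rat set. if F (of_rat r) t \<le> 1 then ennreal (of_rat r) else \<infinity>)" (is "?l = ?r") for t
  proof (rule antisym)
    show "?l \<le> ?r"
    proof (intro INF_greatest)
      fix r :: rat assume "r \<in> {0<..}"
      then have "0 < (of_rat r :: real)" by simp
      then show "?l \<le> (if F (of_rat r) t \<le> 1 then ennreal (of_rat r) else \<infinity>)"
        using Lp_norm_le[of "of_rat r" p "\<lambda>x. of_real (K x t)"] mod[of "of_rat r" t] by auto
    qed
    show "?r \<le> ?l"
      unfolding Lp_norm_def
    proof (intro Inf_greatest; clarify)
      fix \<eta> :: real assume \<eta>: "0 < \<eta>" "modular p (\<lambda>x. of_real (K x t) / of_real \<eta>) \<le> 1"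
      show "?r \<le> ennreal \<eta>"
      proof (rule ennreal_le_epsilon)
        fix e :: real assume "0 < e"
        then obtain r where r: "\<eta> < of_rat r" "of_rat r < \<eta> + e"
          using of_rat_dense[of \<eta> "\<eta> + e"] by auto
        have "0 < (of_rat r :: real)"
          by (rule less_trans[OF \<eta>(1) r(1)])
        then have r0: "r \<in> {0<..}"
          by simp
        have "F (of_rat r) t \<le> F \<eta> t"
          unfolding F_def using r(1) \<eta>(1) \<open>0 < (of_rat r :: real)\<close>
          by (intro nn_integral_mono ennreal_leI powr_mono2 frac_le) auto
        then have "F (of_rat r) t \<le> 1"
          using \<eta> by (simp add: mod)
        then have "?r \<le> ennreal (of_rat r)"
          by (intro INF_lower2[OF r0]) simp
        also have "\<dots> \<le> ennreal \<eta> + ennreal e"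
          using r(2) \<eta>(1) \<open>0 < e\<close> by (simp add: ennreal_plus[symmetric] ennreal_leI del: ennreal_plus)
        finally show "?r \<le> ennreal \<eta> + ennreal e" .
      qed
    qed
  qed
  show ?thesis
    unfolding eq by (intro borel_measurable_INF) auto
qed

section \<open>Minkowski's integral inequality with a variable exponent\<close>

text \<open>
  The convexity argument behind Minkowski's inequality: \<open>S\<^sup>-\<^sup>1 \<integral> K x t dt\<close> is the mean of \<open>K x t / N t\<close> with respect to
  the density \<open>N / S\<close>.  Jensen's inequality for fixed \<open>x\<close>, with its own exponent \<open>p x\<close>, is integrated over \<open>x\<close>,
  and Tonelli's theorem brings in the bound on the modulars of \<open>K \<cdot> t / N t\<close>.  The same bound shows that
  the integrals converge for almost every \<open>x\<close>.
\<close>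

lemma integral_powr_le_1_by_jensen:
  fixes K :: "'x \<Rightarrow> 't \<Rightarrow> real" and N :: "'t \<Rightarrow> real" and p :: "'x \<Rightarrow> real"
  assumes M: "sigma_finite_measure M" and T: "sigma_finite_measure T"
    and Km[measurable]: "(\<lambda>z. K (fst z) (snd z)) \<in> borel_measurable (M \<Otimes>\<^sub>M T)"
    and [measurable]: "p \<in> borel_measurable M" "N \<in> borel_measurable T"
    and K: "\<And>x t. 0 \<le> K x t" and p: "\<And>x. 1 \<le> p x" and N: "\<And>t. 0 < N t"
    and S: "0 < S" "(\<integral>\<^sup>+t. ennreal (N t) \<partial>T) \<le> ennreal S"
    and mod: "AE t in T. (\<integral>\<^sup>+x. ennreal ((K x t / N t) powr p x) \<partial>M) \<le> 1"
  shows "AE x in M. integrable T (K x)"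
    and "(\<integral>\<^sup>+x. ennreal (((\<integral>t. K x t \<partial>T) / S) powr p x) \<partial>M) \<le> 1"
proof -
  interpret M: sigma_finite_measure M by (rule M)
  interpret T: sigma_finite_measure T by (rule T)
  interpret pair_sigma_finite M T ..
  define G where "G x t = ennreal ((K x t / N t) powr p x * (N t / S))" for x t
  have [measurable]: "(\<lambda>z. G (fst z) (snd z)) \<in> borel_measurable (M \<Otimes>\<^sub>M T)"
    unfolding G_def by measurable
  have N1: "(\<integral>\<^sup>+t. ennreal (N t / S) \<partial>T) \<le> 1"
  proof -
    have "(\<integral>\<^sup>+t. ennreal (N t / S) \<partial>T) = (\<integral>\<^sup>+t. ennreal (1 / S) * ennreal (N t) \<partial>T)"
      using S(1) N by (intro nn_integral_cong) (simp add: ennreal_mult'[symmetric])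
    also have "\<dots> = ennreal (1 / S) * (\<integral>\<^sup>+t. ennreal (N t) \<partial>T)"
      by (intro nn_integral_cmult) measurable
    also have "\<dots> \<le> ennreal (1 / S) * ennreal S"
      by (intro mult_left_mono S) simp
    also have "\<dots> = 1"
      using S(1) by (simp add: ennreal_mult'[symmetric])
    finally show ?thesis .
  qed
  have "(\<integral>\<^sup>+x. \<integral>\<^sup>+t. G x t \<partial>T \<partial>M) = (\<integral>\<^sup>+t. \<integral>\<^sup>+x. G x t \<partial>M \<partial>T)"
    by (rule Fubini'[symmetric]) (simp add: split_beta)
  also have "\<dots> \<le> (\<integral>\<^sup>+t. ennreal (N t / S) \<partial>T)"
  proof (rule nn_integral_mono_AE)
    show "AE t in T. (\<integral>\<^sup>+x. G x t \<partial>M) \<le> ennreal (N t / S)"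
      using mod AE_space
    proof eventually_elim
      case (elim t)
      have [measurable]: "(\<lambda>x. K x t) \<in> borel_measurable M"
        using measurable_Pair1[OF Km elim(2)] by simp
      have "(\<integral>\<^sup>+x. G x t \<partial>M) = (\<integral>\<^sup>+x. ennreal (N t / S) * ennreal ((K x t / N t) powr p x) \<partial>M)"
        unfolding G_def using S(1) N[of t]
        by (intro nn_integral_cong) (simp add: ennreal_mult'[symmetric] mult.commute)
      also have "\<dots> = ennreal (N t / S) * (\<integral>\<^sup>+x. ennreal ((K x t / N t) powr p x) \<partial>M)"
        by (intro nn_integral_cmult) measurable
      also have "\<dots> \<le> ennreal (N t / S) * 1"
        by (intro mult_left_mono elim) simp
      finally show ?case by simp
    qed
  qed
  also note N1
  finally have G1: "(\<integral>\<^sup>+x. \<integral>\<^sup>+t. G x t \<partial>T \<partial>M) \<le> 1" .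
  have "AE x in M. (\<integral>\<^sup>+t. G x t \<partial>T) \<noteq> \<infinity>"
    using G1 by (intro nn_integral_noteq_infinite) (auto simp: top_unique)
  then have ae: "AE x in M. integrable T (K x) \<and>
      ennreal (((\<integral>t. K x t \<partial>T) / S) powr p x) \<le> (\<integral>\<^sup>+t. G x t \<partial>T)"
    using AE_space
  proof eventually_elim
    case (elim x)
    have [measurable]: "K x \<in> borel_measurable T"
      using measurable_Pair2[OF Km elim(2)] by simp
    have fin: "(\<integral>\<^sup>+t. ennreal ((K x t / N t) powr p x * (N t / S)) \<partial>T) < \<infinity>"
      using elim(1) by (simp add: G_def less_top)
    have hw: "K x t / N t * (N t / S) = K x t / S" for t
      using N[of t] by simp
    have J: "integrable T (\<lambda>t. K x t / S)"
      "ennreal ((\<integral>t. K x t / S \<partial>T) powr p x) \<le> (\<integral>\<^sup>+t. G x t \<partial>T)"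
      using jensen_powr_subprobability[of "\<lambda>t. K x t / N t" T "\<lambda>t. N t / S" "p x", OF _ _ _ _ p N1 fin]
        K N S(1) unfolding hw G_def by (simp_all add: less_imp_le)
    have "integrable T (\<lambda>t. S * (K x t / S))"
      using J(1) by (rule integrable_mult_right)
    then show ?case
      using J(2) S(1) by simp
  qed
  then show "AE x in M. integrable T (K x)" by eventually_elim simp
  have "(\<integral>\<^sup>+x. ennreal (((\<integral>t. K x t \<partial>T) / S) powr p x) \<partial>M) \<le> (\<integral>\<^sup>+x. \<integral>\<^sup>+t. G x t \<partial>T \<partial>M)"
    using ae by (intro nn_integral_mono_AE) (auto elim: eventually_mono)
  also note G1
  finally show "(\<integral>\<^sup>+x. ennreal (((\<integral>t. K x t \<partial>T) / S) powr p x) \<partial>M) \<le> 1" .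
qed

text \<open>
  The norm of \<open>K \<cdot> t\<close> may vanish, and its modular after division by the norm is not known to be at most \<open>1\<close>.  Both
  obstacles disappear if the normalising function is the norm plus a small multiple of a strictly positive
  integrable function; its integral exceeds that of the norm by at most \<open>d\<close>, which is arbitrary.
\<close>

lemma Lp_norm_integral_le:
  fixes K :: "(real^'n) \<Rightarrow> 't \<Rightarrow> real"
  assumes T: "sigma_finite_measure T"
    and p: "\<And>x. 1 \<le> p x" "\<And>x. p x \<noteq> \<infinity>" and pm[measurable]: "p \<in> borel_measurable lebesgue"
    and Km[measurable]: "(\<lambda>z. K (fst z) (snd z)) \<in> borel_measurable (lebesgue \<Otimes>\<^sub>M T)"
    and K: "\<And>x t. 0 \<le> K x t"
    and fin: "(\<integral>\<^sup>+t. Lp_norm p (\<lambda>x. of_real (K x t)) \<partial>T) < \<infinity>"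
  shows "AE x in lebesgue. integrable T (K x)"
    and "Lp_norm p (\<lambda>x. of_real (\<integral>t. K x t \<partial>T)) \<le> (\<integral>\<^sup>+t. Lp_norm p (\<lambda>x. of_real (K x t)) \<partial>T)"
proof -
  interpret T: sigma_finite_measure T by (rule T)
  define F where "F t = Lp_norm p (\<lambda>x. of_real (K x t))" for t
  define J where "J = (\<integral>\<^sup>+t. F t \<partial>T)"
  have [measurable]: "F \<in> borel_measurable T"
    unfolding F_def[abs_def] by (rule borel_measurable_Lp_norm[OF p(2) pm Km])
  have J: "J < \<infinity>" using fin by (simp add: J_def F_def)
  obtain e where e[measurable]: "e \<in> borel_measurable T" and e1: "integral\<^sup>N T e \<noteq> \<infinity>" "\<forall>x\<in>space T. 0 < e x \<and> e x < \<infinity>"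
    using T.Ex_finite_integrable_function by blast
  have p1: "1 \<le> enn2real (p x)" for x
    using enn2real_mono[of 1 "p x"] p[of x] by (simp add: less_top)
  have aeF: "AE t in T. F t < \<infinity>"
    using nn_integral_noteq_infinite[of F T] J by (simp add: J_def less_top)
  have key: "(AE x in lebesgue. integrable T (K x)) \<and> Lp_norm p (\<lambda>x. of_real (\<integral>t. K x t \<partial>T)) \<le> J + ennreal d"
    if d: "0 < d" for d :: real
  proof -
    define E where "E = enn2real (integral\<^sup>N T e) + 1"
    have E: "0 < E" "integral\<^sup>N T e \<le> ennreal E"
    proof -
      show "0 < E" by (simp add: E_def add_nonneg_pos)
      have "integral\<^sup>N T e = ennreal (enn2real (integral\<^sup>N T e))"
        using e1(1) by (simp add: less_top)
      also have "\<dots> \<le> ennreal E"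
        by (simp add: E_def ennreal_leI)
      finally show "integral\<^sup>N T e \<le> ennreal E" .
    qed
    \<comment> \<open>The value outside the space of \<open>T\<close> only keeps \<open>N\<close> positive everywhere.\<close>
    define N where "N t = (if t \<in> space T then enn2real (F t) + d / E * enn2real (e t) else 1)" for t
    have Npos: "0 < N t" for t
      using e1(2) d E(1) by (auto simp: N_def enn2real_positive_iff intro!: add_nonneg_pos)
    have [measurable]: "N \<in> borel_measurable T"
      unfolding N_def by (subst measurable_cong[where g = "\<lambda>t. enn2real (F t) + d / E * enn2real (e t)"]) auto
    have "(\<integral>\<^sup>+t. ennreal (N t) \<partial>T) \<le> (\<integral>\<^sup>+t. F t + ennreal (d / E) * e t \<partial>T)"
    proof (rule nn_integral_mono_AE)
      show "AE t in T. ennreal (N t) \<le> F t + ennreal (d / E) * e t"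
        using aeF AE_space
      proof eventually_elim
        case (elim t)
        have "ennreal (N t) = ennreal (enn2real (F t)) + ennreal (d / E) * ennreal (enn2real (e t))"
          using elim(2) d E(1) by (simp add: N_def ennreal_mult'[symmetric])
        then show ?case
          using elim e1(2) by simp
      qed
    qed
    also have "\<dots> = J + ennreal (d / E) * integral\<^sup>N T e"
      by (simp add: nn_integral_add nn_integral_cmult J_def)
    also have "\<dots> \<le> J + ennreal (d / E) * ennreal E"
      by (intro add_left_mono mult_left_mono E) simp
    also have "ennreal (d / E) * ennreal E = ennreal d"
      using E d by (simp add: ennreal_mult'[symmetric])
    finally have NJ: "(\<integral>\<^sup>+t. ennreal (N t) \<partial>T) \<le> J + ennreal d" .
    define S where "S = enn2real J + d"
    have S: "ennreal S = J + ennreal d" "0 < S"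
      using J d by (simp_all add: S_def add_nonneg_pos)
    have mod: "AE t in T. (\<integral>\<^sup>+x. ennreal ((K x t / N t) powr enn2real (p x)) \<partial>lebesgue) \<le> 1"
      using aeF AE_space
    proof eventually_elim
      case (elim t)
      have [measurable]: "(\<lambda>x. K x t) \<in> borel_measurable lebesgue"
        using measurable_Pair1[OF Km elim(2)] by simp
      have "F t = ennreal (enn2real (F t))"
        using elim(1) by simp
      also have "\<dots> < ennreal (N t)"
        using elim(2) e1(2) d E(1) by (intro ennreal_lessI) (auto simp: N_def enn2real_positive_iff intro!: add_nonneg_pos)
      finally have "modular p (\<lambda>x. of_real (K x t) / of_real (N t)) \<le> 1"
        unfolding F_def by (intro modular_le_1_if_Lp_norm_less) measurable
      then show ?case
        using K Npos[of t] by (simp add: modular_finite_exponent[OF p(2)] norm_divide)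
    qed
    note min = integral_powr_le_1_by_jensen[OF sigma_finite_lebesgue T Km _ _ K p1 Npos S(2) _ mod]
    have "AE x in lebesgue. integrable T (K x)"
      using NJ S by (intro min(1)) auto
    moreover have "Lp_norm p (\<lambda>x. of_real (\<integral>t. K x t \<partial>T)) \<le> ennreal S"
    proof (rule Lp_norm_le[OF S(2)])
      have "0 \<le> (\<integral>t. K x t \<partial>T)" for x
        using K by (intro integral_nonneg_AE) auto
      then have "modular p (\<lambda>x. of_real (\<integral>t. K x t \<partial>T) / of_real S)
          = (\<integral>\<^sup>+x. ennreal (((\<integral>t. K x t \<partial>T) / S) powr enn2real (p x)) \<partial>lebesgue)"
        using S(2) by (simp add: modular_finite_exponent[OF p(2)] norm_divide)
      also have "\<dots> \<le> 1"
        using NJ S by (intro min(2)) auto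
      finally show "modular p (\<lambda>x. of_real (\<integral>t. K x t \<partial>T) / of_real S) \<le> 1" .
    qed
    ultimately show ?thesis by (simp add: S)
  qed
  from key[of 1] show "AE x in lebesgue. integrable T (K x)" by simp
  show "Lp_norm p (\<lambda>x. of_real (\<integral>t. K x t \<partial>T)) \<le> (\<integral>\<^sup>+t. Lp_norm p (\<lambda>x. of_real (K x t)) \<partial>T)"
    unfolding F_def[symmetric] J_def[symmetric] by (rule ennreal_le_epsilon) (use key in blast)
qed

section \<open>Matrices, power weights and exponents\<close>

lemma matrix_inv_inverse:
  assumes "invertible (A :: real^'n^'n)"
  shows "A ** matrix_inv A = mat 1" "matrix_inv A ** A = mat 1"
  using someI_ex[OF assms[unfolded invertible_def]] by (auto simp: matrix_inv_def)

lemma invertible_matrix_inv: "invertible (A :: real^'n^'n) \<Longrightarrow> invertible (matrix_inv A)"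
  using matrix_inv_inverse[of A] by (auto simp: invertible_def)

lemma invertible_nonzero:
  assumes "invertible (A :: real^'n^'n)"
  shows "A \<noteq> 0"
proof
  assume "A = 0"
  then have "(A ** matrix_inv A) $ i $ i = 0" for i
    by (simp add: matrix_matrix_mult_def)
  then show False
    by (simp add: matrix_inv_inverse[OF assms] mat_def)
qed

lemma norm_matrix_vector_mult_le: "norm ((A :: real^'n^'m) *v x) \<le> norm A * norm x"
proof -
  have "norm (A *v x) = L2_set (\<lambda>i. \<bar>A $ i \<bullet> x\<bar>) UNIV"
    by (simp add: norm_vec_def matrix_vector_mul_component)
  also have "\<dots> \<le> L2_set (\<lambda>i. norm (A $ i) * norm x) UNIV"
    by (intro L2_set_mono Cauchy_Schwarz_ineq2) simp
  also have "\<dots> = norm A * norm x"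
    by (simp add: norm_vec_def[of A] L2_set_left_distrib)
  finally show ?thesis .
qed

text \<open>
  For \<open>g \<ge> 0\<close> this follows from \<open>|x| \<le> \<parallel>A\<^sup>-\<^sup>1\<parallel> |A x|\<close>, for \<open>g < 0\<close> from \<open>|x| \<ge> |A x| / \<parallel>A\<parallel>\<close>; hence the two terms of
  the first maximum in the constant \<^const>\<open>c_const\<close>.
\<close>

lemma norm_powr_le_matrix:
  fixes A :: "real^'n^'n"
  assumes "invertible A"
  shows "norm x powr g \<le> max (norm A powr (- g)) (norm (matrix_inv A) powr g) * norm (A *v x) powr g"
proof (cases "x = 0")
  case False
  have x: "matrix_inv A *v (A *v x) = x"
    by (simp add: matrix_vector_mul_assoc matrix_inv_inverse[OF assms])
  with False have Ax: "0 < norm (A *v x)"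
    by (metis matrix_vector_mult_0_right zero_less_norm_iff)
  have A: "0 < norm A"
    using Ax by auto
  show ?thesis
  proof (cases "0 \<le> g")
    case True
    have "norm x \<le> norm (matrix_inv A) * norm (A *v x)"
      using norm_matrix_vector_mult_le[of "matrix_inv A" "A *v x"] by (simp add: x)
    then have "norm x powr g \<le> (norm (matrix_inv A) * norm (A *v x)) powr g"
      using True by (intro powr_mono2) auto
    also have "\<dots> = norm (matrix_inv A) powr g * norm (A *v x) powr g"
      by (rule powr_mult)
    also have "\<dots> \<le> max (norm A powr (- g)) (norm (matrix_inv A) powr g) * norm (A *v x) powr g"
      by (intro mult_right_mono) auto
    finally show ?thesis .
  next
    case g: False
    have "norm (A *v x) / norm A \<le> norm x"
      using norm_matrix_vector_mult_le[of A x] A by (simp add: field_simps)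
    then have "norm x powr g \<le> (norm (A *v x) / norm A) powr g"
      using g A Ax by (intro powr_mono2') auto
    also have "\<dots> = norm A powr (- g) * norm (A *v x) powr g"
      by (simp add: powr_divide powr_minus field_simps)
    also have "\<dots> \<le> max (norm A powr (- g)) (norm (matrix_inv A) powr g) * norm (A *v x) powr g"
      by (intro mult_right_mono) auto
    finally show ?thesis .
  qed
qed simp

text \<open>
  With \<open>d\<close> the inverse Jacobian and \<open>s\<close> the value of the exponent, this is what the second maximum in \<^const>\<open>c_const\<close>
  is made for: \<open>1/a\<close> serves when \<open>d \<ge> 1\<close> and \<open>1/b\<close> when \<open>d < 1\<close>.
\<close>

lemma le_powr_max_powr:
  fixes d s a b :: real
  assumes "0 < d" "0 < a" "a \<le> s" "s \<le> b"
  shows "d \<le> max (d powr (1 / b)) (d powr (1 / a)) powr s"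
proof (cases "1 \<le> d")
  case True
  have "d powr 1 \<le> d powr (s / a)"
    using assms True by (intro powr_mono) auto
  also have "\<dots> = (d powr (1 / a)) powr s"
    by (simp add: powr_powr)
  also have "\<dots> \<le> max (d powr (1 / b)) (d powr (1 / a)) powr s"
    using assms by (intro powr_mono2) auto
  finally show ?thesis using assms by simp
next
  case False
  have "d powr 1 \<le> d powr (s / b)"
    using assms False by (intro powr_mono') auto
  also have "\<dots> = (d powr (1 / b)) powr s"
    by (simp add: powr_powr)
  also have "\<dots> \<le> max (d powr (1 / b)) (d powr (1 / a)) powr s"
    using assms by (intro powr_mono2) auto
  finally show ?thesis using assms by simp
qed

lemma var_exponents_bD:
  assumes "Q \<in> var_exponents_b"
  shows "Q \<in> borel_measurable lebesgue" "1 \<le> Q x" "Q x \<noteq> \<infinity>"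
    "1 < enn2real (exp_minus Q)" "enn2real (exp_minus Q) \<le> enn2real (Q x)" "enn2real (Q x) \<le> enn2real (exp_plus Q)"
proof -
  have Q: "Q \<in> borel_measurable lebesgue" "1 \<le> Q x" "1 < exp_minus Q" "exp_minus Q \<le> Q x" "Q x \<le> exp_plus Q" "exp_plus Q < \<infinity>" for x
    using assms by (auto simp: var_exponents_b_def var_exponents_def)
  show "Q \<in> borel_measurable lebesgue" "1 \<le> Q x" by (fact Q)+
  have fin: "Q x < top" "exp_minus Q < top" "exp_plus Q < top"
    using Q(4,5)[of x] Q(6) by (auto intro: order_le_less_trans)
  show "Q x \<noteq> \<infinity>" using fin by auto
  show "enn2real (exp_minus Q) \<le> enn2real (Q x)" "enn2real (Q x) \<le> enn2real (exp_plus Q)"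
    using Q(4,5) fin by (auto intro: enn2real_mono)
  have "ennreal 1 < ennreal (enn2real (exp_minus Q))"
    using Q(3) fin by simp
  then show "1 < enn2real (exp_minus Q)"
    by (subst (asm) ennreal_less_iff) auto
qed

lemma modular_const_le_1D:
  fixes r :: "(real^'n) \<Rightarrow> ennreal"
  assumes [measurable]: "r \<in> borel_measurable lebesgue" and "0 < \<rho>"
    and mod: "modular r (\<lambda>x. 1 / of_real \<rho>) \<le> 1"
  shows "AE x in lebesgue. r x = \<infinity> \<longrightarrow> 1 / \<rho> \<le> 1"
    and "(\<integral>\<^sup>+x. ennreal ((1 / \<rho>) powr enn2real (r x)) * indicator {x. r x \<noteq> \<infinity>} x \<partial>lebesgue) \<le> 1"
proof -
  have n: "cmod (1 / of_real \<rho>) = 1 / \<rho>"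
    using \<open>0 < \<rho>\<close> by (simp add: norm_divide)
  have sum: "(\<integral>\<^sup>+x. ennreal ((1 / \<rho>) powr enn2real (r x)) * indicator {x. r x \<noteq> \<infinity>} x \<partial>lebesgue)
      + esssup (restrict_space lebesgue {x. r x = \<infinity>}) (\<lambda>x::real^'n. ennreal (1 / \<rho>)) \<le> 1"
    using mod unfolding modular_def n .
  then show "(\<integral>\<^sup>+x. ennreal ((1 / \<rho>) powr enn2real (r x)) * indicator {x. r x \<noteq> \<infinity>} x \<partial>lebesgue) \<le> 1"
    by (rule order_trans[rotated]) simp
  have le1: "esssup (restrict_space lebesgue {x. r x = \<infinity>}) (\<lambda>x::real^'n. ennreal (1 / \<rho>)) \<le> 1"
    using sum by (rule order_trans[rotated]) simp
  have sets: "{x \<in> space lebesgue. r x = \<infinity>} \<in> sets lebesgue"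
    by measurable
  from esssup_AE[of "\<lambda>x::real^'n. ennreal (1 / \<rho>)" "restrict_space lebesgue {x. r x = \<infinity>}"]
  have "AE x in restrict_space lebesgue {x. r x = \<infinity>}. ennreal (1 / \<rho>) \<le> 1"
    by (rule eventually_mono) (rule order_trans[OF _ le1])
  then show "AE x in lebesgue. r x = \<infinity> \<longrightarrow> 1 / \<rho> \<le> 1"
    using sets by (subst (asm) AE_restrict_space_iff) auto
qed

text \<open>
  Translation of the truncated \<^typ>\<open>ennreal\<close> arithmetic in \<^const>\<open>r_exponent\<close> into real numbers: either \<open>r\<close> is
  infinite and the two exponents agree, or it is the genuine Hoelder complement.
\<close>

lemma r_exponent_real:
  fixes A :: "real^'n^'n"
  assumes Q: "Q \<in> var_exponents_b" and "0 < \<zeta>" and le: "Q (matrix_inv A *v y) \<le> ennreal \<zeta> * Q y"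
  defines "s \<equiv> enn2real (Q (matrix_inv A *v y))" and "p \<equiv> enn2real (ennreal \<zeta> * Q y)"
  defines "r \<equiv> r_exponent A Q \<zeta> y"
  shows "1 < s" "s \<le> p" "r = \<infinity> \<Longrightarrow> p = s" "r \<noteq> \<infinity> \<Longrightarrow> 0 < enn2real r \<and> 1 / p + 1 / enn2real r = 1 / s"
proof -
  show s: "1 < s"
    unfolding s_def using var_exponents_bD(4)[OF Q] var_exponents_bD(5)[OF Q, of "matrix_inv A *v y"] by linarith
  have eqs: "Q (matrix_inv A *v y) = ennreal s" "ennreal \<zeta> * Q y = ennreal p"
    using var_exponents_bD(3)[OF Q] by (simp_all add: s_def p_def less_top ennreal_mult_less_top)
  have p0: "0 \<le> p" by (simp add: p_def)
  show sp: "s \<le> p"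
    using le unfolding eqs by (simp add: p0)
  have r: "r = inverse (ennreal (1 / s - 1 / p))"
    using s sp by (simp add: r_def r_exponent_def eqs inverse_ennreal ennreal_minus inverse_eq_divide)
  have d: "0 \<le> 1 / s - 1 / p"
    using s sp by (simp add: frac_le)
  show "p = s" if "r = \<infinity>"
  proof -
    have "1 / s - 1 / p \<le> 0"
      using that unfolding r by (simp add: ennreal_eq_0_iff)
    then show ?thesis using d s sp by (simp add: field_simps)
  qed
  show "0 < enn2real r \<and> 1 / p + 1 / enn2real r = 1 / s" if "r \<noteq> \<infinity>"
  proof -
    have "1 / s - 1 / p \<noteq> 0"
      using that unfolding r by (metis ennreal_0 infinity_ennreal_def ennreal_inverse_eq_top_iff ennreal_inverse_zero)
    with d have pos: "0 < 1 / s - 1 / p" by linarith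
    then have "enn2real r = 1 / (1 / s - 1 / p)"
      unfolding r by (simp add: inverse_ennreal inverse_eq_divide)
    then show ?thesis using pos by simp
  qed
qed

lemma borel_measurable_r_exponent:
  fixes A :: "real^'n^'n"
  assumes "invertible A" and [measurable]: "Q \<in> borel_measurable lebesgue"
  shows "r_exponent A Q \<zeta> \<in> borel_measurable lebesgue"
proof -
  have [measurable]: "(\<lambda>x. Q (matrix_inv A *v x)) \<in> borel_measurable lebesgue"
    by (rule measurable_compose[OF lebesgue_measurable_matrix[OF invertible_matrix_inv[OF assms(1)]] assms(2)])
  show ?thesis
    unfolding r_exponent_def[abs_def] by measurable
qed

section \<open>Norm of a product of dilated functions\<close>

text \<open>
  One factor of the product, normalised.  The total \<open>2 = 1 + 1\<close> comes from the modulars of \<open>g\<close> and of the constant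
  \<open>1\<close> in the Hoelder splitting; where \<open>r\<close> is infinite, the constant is at most \<open>1\<close> almost everywhere and
  can be dropped.
\<close>

lemma nn_integral_dilated_powr_le_2:
  fixes A :: "real^'n^'n" and g :: "(real^'n) \<Rightarrow> complex"
  assumes inv: "invertible A" and Q: "Q \<in> var_exponents_b" and \<zeta>: "0 < \<zeta>"
    and le: "\<And>x. Q (matrix_inv A *v x) \<le> ennreal \<zeta> * Q x"
    and g[measurable]: "g \<in> borel_measurable lebesgue" and \<beta>: "0 < \<beta>" and \<rho>: "0 < \<rho>"
    and mg: "modular (\<lambda>x. ennreal \<zeta> * Q x) (\<lambda>x. g x * of_real (power_weight \<gamma> x) / of_real \<beta>) \<le> 1"
    and mr: "modular (r_exponent A Q \<zeta>) (\<lambda>x. 1 / of_real \<rho>) \<le> 1"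
  shows "(\<integral>\<^sup>+x. ennreal ((cmod (g (A *v x)) * power_weight \<gamma> x / (c_const A Q \<gamma> * \<rho> * \<beta>)) powr enn2real (Q x)) \<partial>lebesgue) \<le> 2"
proof -
  define d where "d = \<bar>det (matrix_inv A)\<bar>"
  define M where "M = max (norm A powr (- \<gamma>)) (norm (matrix_inv A) powr \<gamma>)"
  define D where "D = max (d powr (1 / enn2real (exp_plus Q))) (d powr (1 / enn2real (exp_minus Q)))"
  define u where "u y = cmod (g y) * power_weight \<gamma> y / \<beta>" for y
  define s where "s y = enn2real (Q (matrix_inv A *v y))" for y
  define p where "p y = enn2real (ennreal \<zeta> * Q y)" for y
  define r where "r = r_exponent A Q \<zeta>"
  define W where "W y = ennreal ((u y * (1 / \<rho>)) powr s y)" for y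
  have c: "c_const A Q \<gamma> = M * D"
    by (simp add: c_const_def M_def D_def d_def)
  have dA: "\<bar>det A\<bar> * d = 1"
    using matrix_inv_inverse(1)[OF inv] by (metis d_def abs_mult det_I det_mul abs_one)
  have "invertible (matrix_inv A)" by (rule invertible_matrix_inv[OF inv])
  then have d: "0 < d"
    by (simp add: d_def invertible_det_nz)
  have D: "0 < D"
    using d by (simp add: D_def less_max_iff_disj)
  have "A \<noteq> 0"
    by (rule invertible_nonzero[OF inv])
  then have M: "0 < M"
    by (simp add: M_def less_max_iff_disj)
  have Qm[measurable]: "Q \<in> borel_measurable lebesgue"
    by (rule var_exponents_bD[OF Q])
  have [measurable]: "(\<lambda>x. Q (matrix_inv A *v x)) \<in> borel_measurable lebesgue"
    by (rule measurable_compose[OF lebesgue_measurable_matrix[OF invertible_matrix_inv[OF inv]] Qm])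
  have [measurable]: "s \<in> borel_measurable lebesgue" "p \<in> borel_measurable lebesgue"
    unfolding s_def[abs_def] p_def[abs_def] by measurable
  have [measurable]: "u \<in> borel_measurable lebesgue"
    unfolding u_def[abs_def] by measurable
  have Wm[measurable]: "W \<in> borel_measurable lebesgue"
    unfolding W_def[abs_def] by measurable
  have rm[measurable]: "r \<in> borel_measurable lebesgue"
    unfolding r_def by (rule borel_measurable_r_exponent[OF inv Qm])
  have u0: "0 \<le> u y" for y
    using \<beta> by (simp add: u_def power_weight_def)
  have pw: "0 \<le> power_weight \<gamma> x" for x :: "real^'n"
    by (simp add: power_weight_def)
  have pinf: "ennreal \<zeta> * Q y \<noteq> \<infinity>" for y
    using var_exponents_bD(3)[OF Q, of y] by (simp add: ennreal_mult_eq_top_iff)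
  note re = r_exponent_real[OF Q \<zeta> le, folded s_def p_def r_def]
  note mr' = modular_const_le_1D[OF rm \<rho> mr[folded r_def]]
  \<comment> \<open>Hoelder splitting in the variable \<open>y = A x\<close>.\<close>
  have "(\<integral>\<^sup>+y. W y \<partial>lebesgue) \<le> (\<integral>\<^sup>+y. ennreal (u y powr p y) + ennreal ((1 / \<rho>) powr enn2real (r y)) * indicator {x. r x \<noteq> \<infinity>} y \<partial>lebesgue)"
  proof (rule nn_integral_mono_AE, rule eventually_mono[OF mr'(1)])
    fix y assume y: "r y = \<infinity> \<longrightarrow> 1 / \<rho> \<le> 1"
    show "W y \<le> ennreal (u y powr p y) + ennreal ((1 / \<rho>) powr enn2real (r y)) * indicator {x. r x \<noteq> \<infinity>} y"
    proof (cases "r y = \<infinity>")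
      case True
      then have "u y * (1 / \<rho>) \<le> u y"
        using y u0[of y] by (intro mult_left_le) auto
      then have "(u y * (1 / \<rho>)) powr s y \<le> u y powr p y"
        unfolding re(3)[OF True] using u0[of y] \<rho> re(1)[of y] by (intro powr_mono2) auto
      then show ?thesis
        using True by (simp add: W_def ennreal_leI)
    next
      case False
      have "(u y * (1 / \<rho>)) powr s y \<le> u y powr p y + (1 / \<rho>) powr enn2real (r y)"
        using re(4)[OF False] re(1,2)[of y] u0[of y] \<rho> by (intro mult_powr_le_add_powr) auto
      then show ?thesis
        using False by (simp add: W_def ennreal_plus[symmetric] ennreal_leI del: ennreal_plus)
    qed
  qed
  also have "\<dots> = (\<integral>\<^sup>+y. ennreal (u y powr p y) \<partial>lebesgue)
      + (\<integral>\<^sup>+y. ennreal ((1 / \<rho>) powr enn2real (r y)) * indicator {x. r x \<noteq> \<infinity>} y \<partial>lebesgue)"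
    by (intro nn_integral_add) measurable
  also have "\<dots> \<le> 1 + 1"
  proof (intro add_mono mr'(2))
    have "(\<integral>\<^sup>+y. ennreal (u y powr p y) \<partial>lebesgue)
      = modular (\<lambda>x. ennreal \<zeta> * Q x) (\<lambda>x. g x * of_real (power_weight \<gamma> x) / of_real \<beta>)"
      using \<beta> pw by (simp add: modular_finite_exponent[OF pinf] u_def p_def norm_mult norm_divide)
    then show "(\<integral>\<^sup>+y. ennreal (u y powr p y) \<partial>lebesgue) \<le> 1"
      using mg by simp
  qed
  finally have W2: "(\<integral>\<^sup>+y. W y \<partial>lebesgue) \<le> 2" by simp
  \<comment> \<open>\<open>D\<close> raised to the exponent is at least \<open>d = 1 / |det A|\<close>, which pays for the substitution \<open>y = A x\<close>.\<close>
  have "(\<integral>\<^sup>+x. ennreal ((cmod (g (A *v x)) * power_weight \<gamma> x / (c_const A Q \<gamma> * \<rho> * \<beta>)) powr enn2real (Q x)) \<partial>lebesgue)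
      \<le> (\<integral>\<^sup>+x. ennreal \<bar>det A\<bar> * W (A *v x) \<partial>lebesgue)"
  proof (rule nn_integral_mono)
    fix x
    have sA: "s (A *v x) = enn2real (Q x)"
      by (simp add: s_def matrix_vector_mul_assoc matrix_inv_inverse[OF inv])
    let ?U = "u (A *v x) * (1 / \<rho>)"
    have "cmod (g (A *v x)) * power_weight \<gamma> x / (c_const A Q \<gamma> * \<rho> * \<beta>)
        \<le> cmod (g (A *v x)) * (M * power_weight \<gamma> (A *v x)) / (c_const A Q \<gamma> * \<rho> * \<beta>)"
      using norm_powr_le_matrix[OF inv, of x \<gamma>] M D \<rho> \<beta>
      by (intro divide_right_mono mult_left_mono) (auto simp: M_def power_weight_def c)
    also have "\<dots> = ?U / D"
      using M D \<rho> \<beta> by (simp add: c u_def field_simps)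
    finally have "(cmod (g (A *v x)) * power_weight \<gamma> x / (c_const A Q \<gamma> * \<rho> * \<beta>)) powr enn2real (Q x)
        \<le> (?U / D) powr enn2real (Q x)"
      using M D \<rho> \<beta> pw[of x] by (intro powr_mono2) (auto simp: c)
    also have "\<dots> = ?U powr enn2real (Q x) / D powr enn2real (Q x)"
      by (rule powr_divide)
    also have "\<dots> \<le> ?U powr enn2real (Q x) / d"
    proof (rule divide_left_mono)
      show "d \<le> D powr enn2real (Q x)"
        unfolding D_def using d var_exponents_bD(4-6)[OF Q] by (intro le_powr_max_powr) (auto intro: less_trans[OF zero_less_one])
    qed (use d D in auto)
    also have "\<dots> = \<bar>det A\<bar> * ?U powr enn2real (Q x)"
      using dA d by (simp add: field_simps)
    finally show "ennreal ((cmod (g (A *v x)) * power_weight \<gamma> x / (c_const A Q \<gamma> * \<rho> * \<beta>)) powr enn2real (Q x))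
        \<le> ennreal \<bar>det A\<bar> * W (A *v x)"
      unfolding W_def sA by (simp add: ennreal_mult'[symmetric] ennreal_leI)
  qed
  also have "\<dots> = ennreal \<bar>det A\<bar> * (\<integral>\<^sup>+x. W (A *v x) \<partial>lebesgue)"
    by (intro nn_integral_cmult measurable_compose[OF lebesgue_measurable_matrix[OF inv] Wm])
  also have "\<dots> = (\<integral>\<^sup>+y. W y \<partial>lebesgue)"
    by (rule nn_integral_lebesgue_matrix[OF inv Wm, symmetric])
  also note W2
  finally show ?thesis .
qed

text \<open>
  Used to pass from numbers above the norms, for which the modulars are controlled, to the norms themselves.
  Working with \<open>R i + e\<close> and \<open>b i + e\<close> also covers vanishing norms.
\<close>

lemma ennreal_le_prod_limit:
  fixes R b :: "'m::finite \<Rightarrow> real"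
  assumes "\<And>e. 0 < e \<Longrightarrow> X \<le> ennreal (C * (\<Prod>i\<in>UNIV. c i * (R i + e) * (b i + e)))"
  shows "X \<le> ennreal (C * (\<Prod>i\<in>UNIV. c i * R i * b i))"
proof (rule tendsto_lowerbound)
  have "((\<lambda>e. C * (\<Prod>i\<in>UNIV. c i * (R i + e) * (b i + e))) \<longlongrightarrow> C * (\<Prod>i\<in>UNIV. c i * (R i + 0) * (b i + 0))) (at_right 0)"
    by (intro tendsto_intros)
  then show "((\<lambda>e. ennreal (C * (\<Prod>i\<in>UNIV. c i * (R i + e) * (b i + e)))) \<longlongrightarrow> ennreal (C * (\<Prod>i\<in>UNIV. c i * R i * b i))) (at_right 0)"
    by (intro tendsto_ennrealI) simp
  show "\<forall>\<^sub>F e in at_right 0. X \<le> ennreal (C * (\<Prod>i\<in>UNIV. c i * (R i + e) * (b i + e)))"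
    unfolding eventually_at_right_field using assms by (auto intro: exI[of _ 1])
qed simp

text \<open>
  Each of the \<open>m\<close> factors contributes at most \<open>2\<close> to the modular of the normalised product, and division by
  \<open>2 m \<ge> 1\<close> reduces a modular by at least this factor, because the exponent \<open>q\<close> is at least \<open>1\<close>.
\<close>

lemma Lp_norm_prod_dilated_le:
  fixes A :: "'m::finite \<Rightarrow> real^'n^'n" and g :: "'m \<Rightarrow> (real^'n) \<Rightarrow> complex"
    and Q :: "'m \<Rightarrow> (real^'n) \<Rightarrow> ennreal"
  assumes inv: "\<And>i. invertible (A i)" and Q: "\<And>i. Q i \<in> var_exponents_b" and q: "q \<in> var_exponents_b"
    and sum: "\<And>x. (\<Sum>i\<in>UNIV. inverse (Q i x)) = inverse (q x)" and \<zeta>: "0 < \<zeta>"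
    and le: "\<And>i x. Q i (matrix_inv (A i) *v x) \<le> ennreal \<zeta> * Q i x"
    and g[measurable]: "\<And>i. g i \<in> borel_measurable lebesgue" and \<phi>: "0 \<le> \<phi>"
    and R: "\<And>i. Lp_norm (r_exponent (A i) (Q i) \<zeta>) (\<lambda>_. 1) = ennreal (R i)" "\<And>i. 0 \<le> R i"
    and b: "\<And>i. wLp_norm (\<lambda>x. ennreal \<zeta> * Q i x) (power_weight (\<gamma> i)) (g i) = ennreal (b i)" "\<And>i. 0 \<le> b i"
  shows "Lp_norm q (\<lambda>x. of_real (\<phi> * (\<Prod>i\<in>UNIV. cmod (g i (A i *v x))) * power_weight (\<Sum>i\<in>UNIV. \<gamma> i) x))
    \<le> ennreal (\<phi> * (2 * real CARD('m)) * (\<Prod>i\<in>UNIV. c_const (A i) (Q i) (\<gamma> i) * R i * b i))"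
proof (cases "\<phi> = 0")
  case True
  then show ?thesis
    using Lp_norm_eq_0[of q "\<lambda>_. 0"] var_exponents_bD(3)[OF q] by simp
next
  case False
  with \<phi> have \<phi>: "0 < \<phi>" by simp
  define c where "c i = c_const (A i) (Q i) (\<gamma> i)" for i
  define m where "m = real CARD('m)"
  have m: "1 \<le> m"
    by (simp add: m_def Suc_le_eq)
  have c0: "0 < c i" for i
  proof -
    have "A i \<noteq> 0" "det (matrix_inv (A i)) \<noteq> 0"
      using invertible_nonzero[OF inv[of i]] invertible_matrix_inv[OF inv[of i]]
      by (auto simp: invertible_det_nz)
    then show ?thesis
      by (auto simp: c_def c_const_def less_max_iff_disj intro!: mult_pos_pos)
  qed
  show ?thesis
    unfolding c_def[symmetric] m_def[symmetric]
  proof (rule ennreal_le_prod_limit)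
    fix e :: real assume e: "0 < e"
    define h where "h i x = cmod (g i (A i *v x)) * power_weight (\<gamma> i) x / (c i * (R i + e) * (b i + e))" for i x
    define E where "E = (\<Prod>i\<in>UNIV. c i * (R i + e) * (b i + e))"
    have pos: "0 < R i + e" "0 < b i + e" for i
      using R(2)[of i] b(2)[of i] e by linarith+
    have E: "0 < E"
      unfolding E_def using c0 pos by (intro prod_pos) auto
    have h0: "0 \<le> h i x" for i x
      using c0[of i] pos[of i] by (simp add: h_def power_weight_def)
    have h2: "(\<integral>\<^sup>+x. ennreal (h i x powr enn2real (Q i x)) \<partial>lebesgue) \<le> 2" for i
      unfolding h_def c_def
    proof (rule nn_integral_dilated_powr_le_2[OF inv Q \<zeta> le g pos(2) pos(1)])
      show "modular (\<lambda>x. ennreal \<zeta> * Q i x) (\<lambda>x. g i x * of_real (power_weight (\<gamma> i) x) / of_real (b i + e)) \<le> 1"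
      proof (rule modular_le_1_if_Lp_norm_less)
        show "(\<lambda>x. g i x * of_real (power_weight (\<gamma> i) x)) \<in> borel_measurable lebesgue"
          by measurable
        show "Lp_norm (\<lambda>x. ennreal \<zeta> * Q i x) (\<lambda>x. g i x * of_real (power_weight (\<gamma> i) x)) < ennreal (b i + e)"
          using b[of i] e by (simp add: wLp_norm_def ennreal_less_iff)
      qed
      show "modular (r_exponent (A i) (Q i) \<zeta>) (\<lambda>x. 1 / of_real (R i + e)) \<le> 1"
        by (rule modular_le_1_if_Lp_norm_less) (use R[of i] e in \<open>simp_all add: ennreal_less_iff\<close>)
    qed
    define \<eta> where "\<eta> = \<phi> * (2 * m) * E"
    have \<eta>: "0 < \<eta>"
      using \<phi> m E by (simp add: \<eta>_def)
    have "Lp_norm q (\<lambda>x. of_real (\<phi> * (\<Prod>i\<in>UNIV. cmod (g i (A i *v x))) * power_weight (\<Sum>i\<in>UNIV. \<gamma> i) x)) \<le> ennreal \<eta>"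
    proof (rule Lp_norm_le[OF \<eta>])
      have mono: "(\<phi> * (\<Prod>i\<in>UNIV. cmod (g i (A i *v x))) * power_weight (\<Sum>i\<in>UNIV. \<gamma> i) x / \<eta>) powr enn2real (q x)
          \<le> 1 / (2 * m) * (\<Sum>i\<in>UNIV. h i x powr enn2real (Q i x))" for x
      proof -
        have w: "power_weight (\<Sum>i\<in>UNIV. \<gamma> i) x = (\<Prod>i\<in>UNIV. power_weight (\<gamma> i) x)"
          by (cases "x = 0") (simp_all add: power_weight_def powr_sum)
        have eq: "\<phi> * (\<Prod>i\<in>UNIV. cmod (g i (A i *v x))) * power_weight (\<Sum>i\<in>UNIV. \<gamma> i) x / \<eta> = (\<Prod>i\<in>UNIV. h i x) / (2 * m)"
          using \<phi> m E unfolding h_def w \<eta>_def E_def by (simp add: prod_dividef prod.distrib)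
        have q1: "1 < enn2real (q x)"
          using var_exponents_bD(4)[OF q] var_exponents_bD(5)[OF q, of x] by linarith
        have Q1: "1 < enn2real (Q i x)" for i
          using var_exponents_bD(4)[OF Q] var_exponents_bD(5)[OF Q, of i x] by (meson less_le_trans)
        have inv_eq: "inverse p = ennreal (1 / enn2real p)" if "1 < enn2real p" for p :: ennreal
        proof -
          have "p \<noteq> \<infinity>" using that by auto
          then have "p = ennreal (enn2real p)" by (simp add: less_top)
          then show ?thesis using that
            by (metis inverse_ennreal inverse_eq_divide less_trans zero_less_one)
        qed
        have "ennreal (\<Sum>i\<in>UNIV. 1 / enn2real (Q i x)) = ennreal (1 / enn2real (q x))"
          using sum[of x] by (simp add: inv_eq[OF q1] inv_eq[OF Q1])
        then have s: "(\<Sum>i\<in>UNIV. 1 / enn2real (Q i x)) = 1 / enn2real (q x)"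
          by (subst (asm) ennreal_inj) (auto intro: sum_nonneg)
        have "((\<Prod>i\<in>UNIV. h i x) / (2 * m)) powr enn2real (q x) = (1 / (2 * m)) powr enn2real (q x) * (\<Prod>i\<in>UNIV. h i x) powr enn2real (q x)"
          by (simp add: powr_mult[symmetric])
        also have "\<dots> \<le> 1 / (2 * m) * (\<Sum>i\<in>UNIV. h i x powr enn2real (Q i x))"
        proof (intro mult_mono)
          show "(1 / (2 * m)) powr enn2real (q x) \<le> 1 / (2 * m)"
            using m q1 by (intro powr_le_one_le) auto
          show "(\<Prod>i\<in>UNIV. h i x) powr enn2real (q x) \<le> (\<Sum>i\<in>UNIV. h i x powr enn2real (Q i x))"
            using q1 Q1 s h0 by (intro prod_powr_le_sum_powr) (auto intro: less_trans[OF zero_less_one])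
        qed (use m in auto)
        finally show ?thesis unfolding eq .
      qed
      have w0: "0 \<le> \<phi> * (\<Prod>i\<in>UNIV. cmod (g i (A i *v x))) * power_weight (\<Sum>i\<in>UNIV. \<gamma> i) x" for x
        using \<phi> by (simp add: power_weight_def prod_nonneg)
      have "modular q (\<lambda>x. of_real (\<phi> * (\<Prod>i\<in>UNIV. cmod (g i (A i *v x))) * power_weight (\<Sum>i\<in>UNIV. \<gamma> i) x) / of_real \<eta>)
        = (\<integral>\<^sup>+x. ennreal ((\<phi> * (\<Prod>i\<in>UNIV. cmod (g i (A i *v x))) * power_weight (\<Sum>i\<in>UNIV. \<gamma> i) x / \<eta>) powr enn2real (q x)) \<partial>lebesgue)"
        using w0 \<eta> by (simp only: modular_finite_exponent[OF var_exponents_bD(3)[OF q]] norm_divide norm_of_real abs_of_nonneg abs_of_pos)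
      also have "\<dots> \<le> (\<integral>\<^sup>+x. ennreal (1 / (2 * m)) * (\<Sum>i\<in>UNIV. ennreal (h i x powr enn2real (Q i x))) \<partial>lebesgue)"
        using mono m by (intro nn_integral_mono) (simp add: ennreal_mult'[symmetric] ennreal_leI sum_nonneg)
      also have "\<dots> = ennreal (1 / (2 * m)) * (\<Sum>i\<in>UNIV. \<integral>\<^sup>+x. ennreal (h i x powr enn2real (Q i x)) \<partial>lebesgue)"
      proof -
        have [measurable]: "h i \<in> borel_measurable lebesgue" for i
        proof -
          have [measurable]: "(\<lambda>x. g i (A i *v x)) \<in> borel_measurable lebesgue"
            by (rule measurable_compose[OF lebesgue_measurable_matrix[OF inv] g])
          show ?thesis unfolding h_def[abs_def] by measurable
        qed
        have [measurable]: "Q i \<in> borel_measurable lebesgue" for i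
          by (rule var_exponents_bD[OF Q])
        have "(\<integral>\<^sup>+x. ennreal (1 / (2 * m)) * (\<Sum>i\<in>UNIV. ennreal (h i x powr enn2real (Q i x))) \<partial>lebesgue)
            = ennreal (1 / (2 * m)) * (\<integral>\<^sup>+x. (\<Sum>i\<in>UNIV. ennreal (h i x powr enn2real (Q i x))) \<partial>lebesgue)"
          by (intro nn_integral_cmult) measurable
        also have "(\<integral>\<^sup>+x. (\<Sum>i\<in>UNIV. ennreal (h i x powr enn2real (Q i x))) \<partial>lebesgue)
            = (\<Sum>i\<in>UNIV. \<integral>\<^sup>+x. ennreal (h i x powr enn2real (Q i x)) \<partial>lebesgue)"
          by (intro nn_integral_sum) measurable
        finally show ?thesis .
      qed
      also have "\<dots> \<le> ennreal (1 / (2 * m)) * (\<Sum>i\<in>(UNIV::'m set). 2)"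
        by (intro mult_left_mono sum_mono h2) simp
      also have "\<dots> = ennreal (1 / (2 * m)) * ennreal (2 * m)"
        by (simp add: m_def ennreal_mult ennreal_of_nat_eq_real_of_nat mult.commute)
      also have "\<dots> = 1"
        using m by (simp add: ennreal_mult'[symmetric])
      finally show "modular q (\<lambda>x. of_real (\<phi> * (\<Prod>i\<in>UNIV. cmod (g i (A i *v x))) * power_weight (\<Sum>i\<in>UNIV. \<gamma> i) x) / of_real \<eta>) \<le> 1" .
    qed
    then show "Lp_norm q (\<lambda>x. of_real (\<phi> * (\<Prod>i\<in>UNIV. cmod (g i (A i *v x))) * power_weight (\<Sum>i\<in>UNIV. \<gamma> i) x))
        \<le> ennreal (\<phi> * (2 * m) * (\<Prod>i\<in>UNIV. c i * (R i + e) * (b i + e)))"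
      by (simp add: \<eta>_def E_def)
  qed
qed

section \<open>Measurability of the Hausdorff integrand\<close>

lemma borel_measurable_lebesgue_AE_eq:
  fixes f g :: "'a::euclidean_space \<Rightarrow> 'b::topological_space"
  assumes g: "g \<in> borel_measurable lebesgue" and eq: "AE x in lebesgue. f x = g x"
  shows "f \<in> borel_measurable lebesgue"
proof (rule measurableI)
  fix S :: "'b set" assume "S \<in> sets borel"
  with g have "g -` S \<in> sets lebesgue"
    by (auto dest: measurable_sets)
  then have "f -` S \<in> sets lebesgue"
    by (rule completion.in_sets_AE[rotated]) (use eq in \<open>auto elim: eventually_mono\<close>)
  then show "f -` S \<inter> space lebesgue \<in> sets lebesgue" by simp
qed simp

lemma ex_borel_version_complex:
  fixes f :: "'a::euclidean_space \<Rightarrow> complex"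
  assumes [measurable]: "f \<in> borel_measurable lebesgue"
  obtains g where "g \<in> borel_measurable borel" "AE x in lborel. f x = g x"
proof -
  obtain u where u: "u \<in> borel_measurable lborel" "AE x in lborel. Re (f x) = u x"
    using completion_ex_borel_measurable_real[of "\<lambda>x. Re (f x)" lborel] by auto
  obtain v where v: "v \<in> borel_measurable lborel" "AE x in lborel. Im (f x) = v x"
    using completion_ex_borel_measurable_real[of "\<lambda>x. Im (f x)" lborel] by auto
  show ?thesis
  proof (rule that[of "\<lambda>x. Complex (u x) (v x)"])
    have [measurable]: "u \<in> borel_measurable borel" "v \<in> borel_measurable borel"
      using u v by simp_all
    show "(\<lambda>x. Complex (u x) (v x)) \<in> borel_measurable borel"
      unfolding Complex_eq by measurable
    show "AE x in lborel. f x = Complex (u x) (v x)"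
      using u(2) v(2) by eventually_elim (simp add: complex_eq_iff)
  qed
qed

text \<open>
  The integral of a nonmeasurable \<open>h\<close> is the supremum over the simple functions below it and still monotone.
  The scaling is therefore moved to the measurable side, where linearity is available.
\<close>

lemma nn_integral_le_cmult_nonmeasurable:
  assumes [measurable]: "F \<in> borel_measurable M" and "0 \<le> a"
    and le: "AE x in M. F x \<le> ennreal a * h x"
  shows "(\<integral>\<^sup>+x. F x \<partial>M) \<le> ennreal a * (\<integral>\<^sup>+x. h x \<partial>M)"
proof (cases "a = 0")
  case True
  then have "AE x in M. F x \<le> 0"
    using le by simp
  then have "(\<integral>\<^sup>+x. F x \<partial>M) \<le> (\<integral>\<^sup>+x. 0 \<partial>M)"
    by (rule nn_integral_mono_AE)
  then show ?thesis by simp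
next
  case False
  with \<open>0 \<le> a\<close> have a: "0 < a" by simp
  have 1: "ennreal a * (ennreal (1 / a) * y) = y" "ennreal (1 / a) * (ennreal a * y) = y" for y
    using a by (simp_all add: mult.assoc[symmetric] ennreal_mult'[symmetric])
  have eq: "(\<integral>\<^sup>+x. F x \<partial>M) = ennreal a * (\<integral>\<^sup>+x. ennreal (1 / a) * F x \<partial>M)"
    by (simp add: nn_integral_cmult 1)
  have "(\<integral>\<^sup>+x. ennreal (1 / a) * F x \<partial>M) \<le> (\<integral>\<^sup>+x. h x \<partial>M)"
  proof (rule nn_integral_mono_AE, rule eventually_mono[OF le])
    fix x assume "F x \<le> ennreal a * h x"
    from mult_left_mono[OF this, of "ennreal (1 / a)"] show "ennreal (1 / a) * F x \<le> h x"
      by (simp only: 1) simp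
  qed
  then show ?thesis
    unfolding eq by (rule mult_left_mono) simp
qed

lemma borel_measurable_pair_matrix_vector [measurable]:
  fixes A :: "'t \<Rightarrow> real^'n^'n" and X :: "'t \<Rightarrow> real^'n"
  assumes "A \<in> borel_measurable M" "X \<in> borel_measurable M"
  shows "(\<lambda>z. A z *v X z) \<in> borel_measurable M"
proof (rule borel_measurable_continuous_Pair[OF assms])
  show "continuous_on UNIV (\<lambda>z. (fst z :: real^'n^'n) *v (snd z :: real^'n))"
    unfolding matrix_vector_mult_def by (intro continuous_intros)
qed

lemma measurable_ident_lebesgue_borel: "(\<lambda>x. x) \<in> lebesgue \<rightarrow>\<^sub>M borel"
  by (intro measurable_completion) simp

lemma measurable_lebesgue_pair_projections:
  "fst \<in> (lebesgue :: 'a::euclidean_space measure) \<Otimes>\<^sub>M (lebesgue :: 'b::euclidean_space measure) \<rightarrow>\<^sub>M borel"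
  "f \<in> lebesgue \<rightarrow>\<^sub>M N \<Longrightarrow>
     (\<lambda>z. f (snd z)) \<in> (lebesgue :: 'a measure) \<Otimes>\<^sub>M (lebesgue :: 'b measure) \<rightarrow>\<^sub>M N"
  using measurable_compose[OF measurable_fst measurable_ident_lebesgue_borel]
  by (auto intro: measurable_compose[OF measurable_snd])

lemma borel_measurable_hausdorff_integrand:
  fixes A :: "'m::finite \<Rightarrow> (real^'n) \<Rightarrow> real^'n^'n"
  assumes [measurable]: "\<Phi> \<in> borel_measurable lebesgue" "\<And>i. A i \<in> borel_measurable lebesgue"
    and g[measurable]: "\<And>i. g i \<in> borel_measurable borel"
  shows "(\<lambda>z. hausdorff_integrand \<Phi> A g (fst z) (snd z)) \<in> borel_measurable (lebesgue \<Otimes>\<^sub>M lebesgue)"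
proof -
  note [measurable] = measurable_lebesgue_pair_projections(1)
    measurable_lebesgue_pair_projections(2)[OF measurable_ident_lebesgue_borel]
    measurable_lebesgue_pair_projections(2)[OF assms(1)] measurable_lebesgue_pair_projections(2)[OF assms(2)]
  have [measurable]: "(\<lambda>z. g i (A i (snd z) *v fst z)) \<in> borel_measurable ((lebesgue :: (real^'n) measure) \<Otimes>\<^sub>M lebesgue)" for i
    by (rule measurable_compose[OF _ g]) measurable
  show ?thesis
    unfolding hausdorff_integrand_def by measurable
qed

text \<open>
  For almost every fixed \<open>t\<close>, the points \<open>x\<close> that some \<open>A\<^sub>i(t)\<close> maps into the exceptional null set \<open>N\<^sub>i\<close> form a
  null set.  Once \<open>N\<^sub>i\<close> is enlarged to a Borel null set, the relation between \<open>x\<close> and \<open>t\<close> is measurable and Tonelli's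
  theorem exchanges the roles of the two variables.
\<close>

lemma AE_hausdorff_integrand_eq:
  fixes A :: "'m::finite \<Rightarrow> (real^'n) \<Rightarrow> real^'n^'n"
  assumes [measurable]: "\<Phi> \<in> borel_measurable lebesgue" "\<And>i. A i \<in> borel_measurable lebesgue"
    and inv: "AE t in lebesgue. \<Phi> t \<noteq> 0 \<longrightarrow> (\<forall>i. invertible (A i t))"
    and eq: "\<And>i. AE x in lborel. f i x = g i x"
  shows "AE x in lebesgue. AE t in lebesgue. hausdorff_integrand \<Phi> A f x t = hausdorff_integrand \<Phi> A g x t"
proof -
  have "\<exists>N. {x. f i x \<noteq> g i x} \<subseteq> N \<and> N \<in> sets borel \<and> emeasure lborel N = 0" for i
  proof -
    obtain N where "{x. f i x \<noteq> g i x} \<subseteq> N" "N \<in> sets borel" "emeasure lborel N = 0"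
      using eq[of i] by (auto elim!: AE_E)
    then show ?thesis by blast
  qed
  then obtain N where N: "\<And>i. {x. f i x \<noteq> g i x} \<subseteq> N i" "\<And>i. N i \<in> sets borel" "\<And>i. emeasure lborel (N i) = 0"
    by metis
  note [measurable] = N(2)
  define P where "P x t \<longleftrightarrow> \<Phi> t = 0 \<or> (\<forall>i. A i t *v x \<notin> N i)" for x t
  have "AE t in lebesgue. AE x in lebesgue. P x t"
    using inv
  proof eventually_elim
    case (elim t)
    show ?case
    proof (cases "\<Phi> t = 0")
      case False
      have "AE x in lborel. A i t *v x \<notin> N i" for i
      proof (rule AE_lborel_matrix)
        show "invertible (A i t)" using elim False by blast
        show "AE y in lborel. y \<notin> N i" using N by (intro AE_not_in) auto
      qed
      then have "AE x in lborel. P x t"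
        unfolding P_def by (simp add: AE_all_countable)
      then show ?thesis by (rule AE_completion)
    qed (simp add: P_def)
  qed
  moreover have "{z \<in> space (lebesgue \<Otimes>\<^sub>M lebesgue). P (fst z) (snd z)} \<in> sets (lebesgue \<Otimes>\<^sub>M lebesgue)"
  proof -
    note [measurable] = measurable_lebesgue_pair_projections(1)
      measurable_lebesgue_pair_projections(2)[OF assms(1)] measurable_lebesgue_pair_projections(2)[OF assms(2)]
    show ?thesis
      unfolding P_def by measurable
  qed
  ultimately have "AE x in lebesgue. AE t in lebesgue. P x t"
    by (subst lebesgue_pair.AE_commute) auto
  then show ?thesis
  proof (rule eventually_mono, elim eventually_mono)
    fix x t assume "P x t"
    then show "hausdorff_integrand \<Phi> A f x t = hausdorff_integrand \<Phi> A g x t"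
      unfolding P_def hausdorff_integrand_def using N(1) by (auto intro!: prod.cong)
  qed
qed

section \<open>Boundedness of the multilinear Hausdorff operator\<close>

theorem theorem3p1:
  fixes \<Phi> :: "(real^'n) \<Rightarrow> real"
    and A :: "'m::finite \<Rightarrow> (real^'n) \<Rightarrow> real^'n^'n"
    and \<gamma> :: "'m \<Rightarrow> real"
    and q\<^sub>i :: "'m \<Rightarrow> (real^'n) \<Rightarrow> ennreal"
    and q :: "(real^'n) \<Rightarrow> ennreal"
    and \<zeta> :: real
  assumes "\<Phi> \<in> borel_measurable lebesgue" and "\<And>t. 0 \<le> \<Phi> t"
    and "\<And>i. A i \<in> borel_measurable lebesgue"
    and "AE t in lebesgue. t \<in> supp \<Phi> \<longrightarrow> (\<forall>i. invertible (A i t))"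
    and "\<And>i. q\<^sub>i i \<in> var_exponents_b" and "q \<in> var_exponents_b"
    and "\<And>x. (\<Sum>i\<in>UNIV. inverse (q\<^sub>i i x)) = inverse (q x)"
    and "0 < \<zeta>"
    and "AE t in lebesgue. t \<in> supp \<Phi> \<longrightarrow>
           (\<forall>i. (\<forall>x. q\<^sub>i i (matrix_inv (A i t) *v x) \<le> ennreal \<zeta> * q\<^sub>i i x) \<and>
                Lp_norm (r_exponent (A i t) (q\<^sub>i i) \<zeta>) (\<lambda>_. 1) < \<infinity>)"
    and "(\<integral>\<^sup>+t. ennreal (\<Phi> t / norm t ^ CARD('n)) *
            (\<Prod>i\<in>UNIV. ennreal (c_const (A i t) (q\<^sub>i i) (\<gamma> i)) *
                       Lp_norm (r_exponent (A i t) (q\<^sub>i i) \<zeta>) (\<lambda>_. 1)) \<partial>lebesgue) < \<infinity>"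
  shows "hausdorff_bounded \<Phi> A
           (\<lambda>i x. ennreal \<zeta> * q\<^sub>i i x) (\<lambda>i. power_weight (\<gamma> i))
           q (power_weight (\<Sum>i\<in>UNIV. \<gamma> i))"
proof -
  note \<Phi>m[measurable] = assms(1) and Am[measurable] = assms(3)
  note Q = assms(5) and q = assms(6) and \<zeta> = assms(8)
  define m where "m = real CARD('m)"
  define \<phi> where "\<phi> t = \<Phi> t / norm t ^ CARD('n)" for t
  define H where "H t = ennreal (\<phi> t) *
      (\<Prod>i\<in>UNIV. ennreal (c_const (A i t) (q\<^sub>i i) (\<gamma> i)) * Lp_norm (r_exponent (A i t) (q\<^sub>i i) \<zeta>) (\<lambda>_. 1))" for t
  define C1 where "C1 = (\<integral>\<^sup>+t. H t \<partial>lebesgue)"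
  define C where "C = enn2real (ennreal (2 * m) * C1)"
  let ?p = "\<lambda>i x. ennreal \<zeta> * q\<^sub>i i x"
  let ?w = "power_weight (\<Sum>i\<in>UNIV. \<gamma> i) :: (real^'n) \<Rightarrow> real"
  have C1: "C1 < \<infinity>"
    using assms(10) by (simp add: C1_def H_def \<phi>_def)
  have C: "ennreal C = ennreal (2 * m) * C1"
    using C1 by (simp add: C_def ennreal_mult_less_top)
  have \<phi>0: "0 \<le> \<phi> t" for t
    using assms(2) by (simp add: \<phi>_def)
  have qinf: "q x \<noteq> \<infinity>" for x by (rule var_exponents_bD[OF q])
  have pinf: "?p i x \<noteq> \<infinity>" for i x
    using var_exponents_bD(3)[OF Q[of i], of x] by (simp add: ennreal_mult_eq_top_iff)
  have pm[measurable]: "?p i \<in> borel_measurable lebesgue" for i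
    using var_exponents_bD(1)[OF Q[of i]] by measurable
  have pge: "\<zeta> \<le> enn2real (?p i x)" for i x
  proof -
    have "1 \<le> enn2real (q\<^sub>i i x)"
      using var_exponents_bD(4)[OF Q[of i]] var_exponents_bD(5)[OF Q[of i], of x] by linarith
    then show ?thesis
      using \<zeta> by (simp add: enn2real_mult)
  qed
  have supp: "t \<in> supp \<Phi>" if "\<Phi> t \<noteq> 0" for t
    using that closure_subset[of "{t. \<Phi> t \<noteq> 0}"] by (auto simp: supp_def)
  have inv: "AE t in lebesgue. \<Phi> t \<noteq> 0 \<longrightarrow> (\<forall>i. invertible (A i t))"
    using assms(4) supp by (auto elim!: eventually_mono)
  have main: "(AE x in lebesgue. integrable lebesgue (hausdorff_integrand \<Phi> A f x)) \<and>
      hausdorff_op \<Phi> A f \<in> wLp_space q ?w \<and>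
      wLp_norm q ?w (hausdorff_op \<Phi> A f)
        \<le> ennreal C * (\<Prod>i\<in>UNIV. wLp_norm (?p i) (power_weight (\<gamma> i)) (f i))"
    if f: "\<forall>i. f i \<in> wLp_space (?p i) (power_weight (\<gamma> i))" for f :: "'m \<Rightarrow> (real^'n) \<Rightarrow> complex"
  proof -
    have fm: "f i \<in> borel_measurable lebesgue" for i
      using f by (simp add: wLp_space_def)
    have "\<exists>g. g \<in> borel_measurable borel \<and> (AE x in lborel. f i x = g x)" for i
      using ex_borel_version_complex[OF fm[of i]] by metis
    then obtain g where g: "\<And>i. g i \<in> borel_measurable borel" "\<And>i. AE x in lborel. f i x = g i x"
      by metis
    have gm: "g i \<in> borel_measurable lebesgue" for i
      using g(1) by (intro measurable_completion) simp
    have fg: "AE x in lebesgue. f i x = g i x" for i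
      by (rule AE_completion[OF g(2)])
    \<comment> \<open>The norms are finite, so that no product \<open>0 \<cdot> \<infinity>\<close> can occur in the bound.\<close>
    define b where "b i = enn2real (wLp_norm (?p i) (power_weight (\<gamma> i)) (f i))" for i
    have b0: "0 \<le> b i" for i by (simp add: b_def)
    have bf: "wLp_norm (?p i) (power_weight (\<gamma> i)) (f i) = ennreal (b i)" for i
    proof -
      have "wLp_norm (?p i) (power_weight (\<gamma> i)) (f i) < \<infinity>"
        unfolding wLp_norm_def using f by (intro Lp_norm_finite[OF _ pinf pm \<zeta> pge]) (simp add: wLp_space_def)
      then show ?thesis by (simp add: b_def)
    qed
    have bg: "wLp_norm (?p i) (power_weight (\<gamma> i)) (g i) = ennreal (b i)" for i
      unfolding bf[symmetric] wLp_norm_def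
      by (rule antisym; rule Lp_norm_mono_AE[OF pinf]; rule eventually_mono[OF fg[of i]]) simp_all
    define K where "K x t = \<phi> t * (\<Prod>i\<in>UNIV. cmod (g i (A i t *v x))) * ?w x" for x t
    have K: "K x t = cmod (hausdorff_integrand \<Phi> A g x t) * ?w x" for x t
      unfolding K_def hausdorff_integrand_def \<phi>_def[symmetric]
      using \<phi>0[of t] by (simp only: norm_mult norm_of_real abs_of_nonneg prod_norm)
    have w0: "0 \<le> ?w x" for x by (simp add: power_weight_def)
    have K0: "0 \<le> K x t" for x t
      unfolding K using w0 by simp
    have hm[measurable]: "(\<lambda>z. hausdorff_integrand \<Phi> A g (fst z) (snd z)) \<in> borel_measurable (lebesgue \<Otimes>\<^sub>M lebesgue)"
      by (rule borel_measurable_hausdorff_integrand[OF \<Phi>m Am g(1)])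
    have Km: "(\<lambda>z. K (fst z) (snd z)) \<in> borel_measurable (lebesgue \<Otimes>\<^sub>M lebesgue)"
      unfolding K by measurable
    define J where "J = (\<integral>\<^sup>+t. Lp_norm q (\<lambda>x. of_real (K x t)) \<partial>lebesgue)"
    have "J \<le> ennreal (2 * m * (\<Prod>i\<in>UNIV. b i)) * C1"
      unfolding J_def C1_def
    proof (rule nn_integral_le_cmult_nonmeasurable)
      show "(\<lambda>t. Lp_norm q (\<lambda>x. of_real (K x t))) \<in> borel_measurable lebesgue"
        by (rule borel_measurable_Lp_norm[OF qinf var_exponents_bD(1)[OF q] Km])
      show "0 \<le> 2 * m * prod b UNIV"
        using b0 by (simp add: m_def prod_nonneg)
      show "AE t in lebesgue. Lp_norm q (\<lambda>x. of_real (K x t)) \<le> ennreal (2 * m * prod b UNIV) * H t"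
        using inv assms(9)
      proof eventually_elim
        case (elim t)
        show ?case
        \<comment> \<open>The hypotheses on \<open>A i t\<close> are used only where \<open>\<Phi> t \<noteq> 0\<close>; elsewhere \<open>K\<close> vanishes.\<close>
        proof (cases "\<Phi> t = 0")
          case True
          then have "K x t = 0" for x by (simp add: K_def \<phi>_def)
          then show ?thesis
            using Lp_norm_eq_0[of q "\<lambda>_. 0"] qinf by simp
        next
          case False
          define R where "R i = enn2real (Lp_norm (r_exponent (A i t) (q\<^sub>i i) \<zeta>) (\<lambda>_. 1))" for i
          define c where "c i = c_const (A i t) (q\<^sub>i i) (\<gamma> i)" for i
          have c0: "0 \<le> c i" for i
            unfolding c_def c_const_def by (intro mult_nonneg_nonneg) (simp_all add: le_max_iff_disj)
          have R: "Lp_norm (r_exponent (A i t) (q\<^sub>i i) \<zeta>) (\<lambda>_. 1) = ennreal (R i)" for i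
            using elim supp[OF False] by (simp add: R_def)
          have R0: "0 \<le> R i" for i by (simp add: R_def)
          have "Lp_norm q (\<lambda>x. of_real (K x t)) \<le> ennreal (\<phi> t * (2 * m) * (\<Prod>i\<in>UNIV. c i * R i * b i))"
            unfolding K_def m_def c_def
            using elim False supp[OF False]
            by (intro Lp_norm_prod_dilated_le[OF _ Q q assms(7) \<zeta> _ gm \<phi>0 R R0 bg b0]) auto
          also have "\<dots> = ennreal (2 * m * prod b UNIV) * H t"
          proof -
            have "(\<Prod>i\<in>UNIV. ennreal (c i) * ennreal (R i)) = ennreal (\<Prod>i\<in>UNIV. c i * R i)"
              using c0 R0 by (subst prod_ennreal[symmetric]) (simp_all add: ennreal_mult)
            then have H: "H t = ennreal (\<phi> t * (\<Prod>i\<in>UNIV. c i * R i))"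
              unfolding H_def R c_def[symmetric] by (simp only: ennreal_mult'[OF \<phi>0])
            have "\<phi> t * (2 * m) * (\<Prod>i\<in>UNIV. c i * R i * b i)
                = 2 * m * prod b UNIV * (\<phi> t * (\<Prod>i\<in>UNIV. c i * R i))"
              by (simp add: prod.distrib)
            moreover have "0 \<le> 2 * m * prod b UNIV"
              using b0 by (simp add: m_def prod_nonneg)
            ultimately show ?thesis
              unfolding H by (simp only: ennreal_mult')
          qed
          finally show ?thesis .
        qed
      qed
    qed
    also have "\<dots> = ennreal C * (\<Prod>i\<in>UNIV. wLp_norm (?p i) (power_weight (\<gamma> i)) (f i))"
    proof -
      have "ennreal (2 * m * prod b UNIV) = ennreal (2 * m) * (\<Prod>i\<in>UNIV. ennreal (b i))"
        using b0 by (simp add: prod_ennreal ennreal_mult' m_def prod_nonneg)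
      then show ?thesis
        unfolding bf C by (simp only: ac_simps)
    qed
    finally have J: "J \<le> ennreal C * (\<Prod>i\<in>UNIV. wLp_norm (?p i) (power_weight (\<gamma> i)) (f i))" .
    have "ennreal C * (\<Prod>i\<in>UNIV. wLp_norm (?p i) (power_weight (\<gamma> i)) (f i)) < \<infinity>"
      unfolding bf using b0 by (simp add: prod_ennreal ennreal_mult_less_top)
    with J have Jfin: "J < \<infinity>" by (rule order_le_less_trans)
    note mink = Lp_norm_integral_le[OF sigma_finite_lebesgue var_exponents_bD(2)[OF q] qinf
        var_exponents_bD(1)[OF q] Km K0 Jfin[unfolded J_def], folded J_def]
    have hx: "hausdorff_integrand \<Phi> A g x \<in> borel_measurable lebesgue" for x
      using measurable_Pair2[OF hm, of x] by simp
    \<comment> \<open>Away from the origin the weight is positive and can be divided out.\<close>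
    have "AE x in lborel. x \<noteq> (0 :: real^'n)"
      by (rule AE_lborel_singleton)
    then have "AE x in lebesgue. x \<noteq> (0 :: real^'n)"
      by (rule AE_completion)
    with mink(1) have intg: "AE x in lebesgue. integrable lebesgue (hausdorff_integrand \<Phi> A g x)"
    proof eventually_elim
      case (elim x)
      then have w: "0 < ?w x" by (simp add: power_weight_def)
      have "integrable lebesgue (\<lambda>t. (1 / ?w x) * K x t)"
        using elim(1) by (rule integrable_mult_right)
      then have "integrable lebesgue (\<lambda>t. cmod (hausdorff_integrand \<Phi> A g x t))"
        using w by (simp add: K)
      then show ?case
        using hx integrable_norm_iff by blast
    qed
    have eq: "AE x in lebesgue. AE t in lebesgue. hausdorff_integrand \<Phi> A f x t = hausdorff_integrand \<Phi> A g x t"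
      by (rule AE_hausdorff_integrand_eq[OF \<Phi>m Am inv g(2)])
    have all: "AE x in lebesgue. integrable lebesgue (hausdorff_integrand \<Phi> A f x) \<and>
        hausdorff_op \<Phi> A f x = hausdorff_op \<Phi> A g x"
      using intg eq
    proof eventually_elim
      case (elim x)
      have fx: "hausdorff_integrand \<Phi> A f x \<in> borel_measurable lebesgue"
        by (rule borel_measurable_lebesgue_AE_eq[OF hx elim(2)])
      show ?case
        using elim integrable_cong_AE[OF fx hx elim(2)] integral_cong_AE[OF fx hx elim(2)]
        by (simp add: hausdorff_op_def)
    qed
    have opg: "hausdorff_op \<Phi> A g \<in> borel_measurable lebesgue"
      unfolding hausdorff_op_def[abs_def]
      by (rule lebesgue.borel_measurable_lebesgue_integral) (simp add: split_beta hm)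
    have opf[measurable]: "hausdorff_op \<Phi> A f \<in> borel_measurable lebesgue"
      by (rule borel_measurable_lebesgue_AE_eq[OF opg]) (use all in \<open>auto elim: eventually_mono\<close>)
    have "wLp_norm q ?w (hausdorff_op \<Phi> A f) \<le> Lp_norm q (\<lambda>x. of_real (\<integral>t. K x t \<partial>lebesgue))"
      unfolding wLp_norm_def
    proof (rule Lp_norm_mono_AE[OF qinf], rule eventually_mono[OF all])
      fix x assume "integrable lebesgue (hausdorff_integrand \<Phi> A f x) \<and> hausdorff_op \<Phi> A f x = hausdorff_op \<Phi> A g x"
      then have "cmod (hausdorff_op \<Phi> A f x * of_real (?w x)) = cmod (hausdorff_op \<Phi> A g x) * ?w x"
        using w0[of x] by (simp add: norm_mult)
      also have "\<dots> \<le> (\<integral>t. cmod (hausdorff_integrand \<Phi> A g x t) \<partial>lebesgue) * ?w x"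
        unfolding hausdorff_op_def by (intro mult_right_mono integral_norm_bound w0)
      also have "\<dots> = (\<integral>t. K x t \<partial>lebesgue)"
        unfolding K by simp
      finally show "cmod (hausdorff_op \<Phi> A f x * of_real (?w x)) \<le> cmod (of_real (\<integral>t. K x t \<partial>lebesgue))"
        by simp
    qed
    also note mink(2)
    finally have norm: "wLp_norm q ?w (hausdorff_op \<Phi> A f) \<le> J" .
    have "(\<lambda>x. hausdorff_op \<Phi> A f x * of_real (?w x)) \<in> Lp_space q"
    proof (rule Lp_space_if_Lp_norm_finite)
      show "(\<lambda>x. hausdorff_op \<Phi> A f x * of_real (?w x)) \<in> borel_measurable lebesgue"
        by measurable
      show "Lp_norm q (\<lambda>x. hausdorff_op \<Phi> A f x * of_real (?w x)) < \<infinity>"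
        using norm Jfin unfolding wLp_norm_def by (rule order_le_less_trans)
    qed
    then show ?thesis
      using all opf order_trans[OF norm J] by (auto simp: wLp_space_def elim: eventually_mono)
  qed
  have "0 \<le> C" by (simp add: C_def)
  with main show ?thesis
    unfolding hausdorff_bounded_def by blast
qed

end
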